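(* For $(\mathsf{FinProb},-/\mathsf{FinProb})$: (1) the universal baseless $\mathsf{IcOrdAb}$-entropy is $(H_0,H_1):\mathsf{FinProb}\to(\log\mathbb{Q}_{>0})\times\mathbb{R}$; (2) the universal baseless $\mathsf{IcOrdVect}_{\mathbb{Q}}$-entropy is $(H_0,H_1):\mathsf{FinProb}\to(\mathbb{Q}\log\mathbb{Q}_{>0})\times\mathbb{R}$, where $(\mathbb{Q}\log\mathbb{Q}_{>0})\times\mathbb{R}=\{(a\log b,c):a\in\mathbb{Q},b\in\mathbb{Q}_{>0},c\in\mathbb{R}\}$. Both codomains carry componentwise addition and the product order inherited from $\mathbb{R}^2$.
   Context: **FinProb.** $\mathsf{FinProb}$ has as objects strictly positive probability mass functions $P$ on finite sets $\mathrm{supp}(P)$; a morphism $P\to Q$ is a measure-preserving function $f$, i.e. $Q(y)=\sum_{x\in f^{-1}(y)}P(x)$. The tensor product is the product distribution; the unit $I$ is the one-point distribution. The under category $P/\mathsf{FinProb}$ has objects $X:P\to A$ and morphisms $X\to X'$ given by $f:A\to A'$ with $fX=X'$; its tensor product $X\otimes_PY$ is the joint random variable $x\mapsto(X(x),Y(x))$ with codomain the pushforward of $P$ on the image of $(X,Y)$, and its unit $I_P$ is $P\to I$. $H_1(P)=-\sum_xP(x)\log P(x)$, $H_0(P)=\log|\mathrm{supp}(P)|$. **Codomains.** $\mathsf{IcOrdAb}$: partially ordered abelian groups (translation-invariant partial order) that are integrally closed ($nx\le y$ for all integers $n\ge1$ implies $x\le0$), with order-preserving homomorphisms. $\mathsf{IcOrdVect}_{\mathbb{Q}}$: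 ordered vector spaces over $\mathbb{Q}$ (translation-invariant partial order, with $x\ge y\Rightarrow ax\ge ay$ for scalars $a\ge0$) that are integrally closed in the same sense, with order-preserving linear maps. $\log\mathbb{Q}_{>0}=\{\log q:q\in\mathbb{Q}_{>0}\}$. **Entropies.** Write $\mathsf{C}=\mathsf{FinProb}$. For a category $\mathsf{V}$ of ordered commutative monoids, a $\mathsf{V}$-entropy of $(\mathsf{C},-/\mathsf{C})$ with values in $W\in\mathsf{V}$ is a monoidal natural transformation $h:-/\mathsf{C}\Rightarrow\Delta_W$; unpacked: functions $h_P:\mathrm{Ob}(P/\mathsf{C})\to W$, $P\in\mathsf{C}$, such that (1) $h_P(X)\ge h_P(X')$ if there is a morphism $X\to X'$ in $P/\mathsf{C}$; (2) $h_P(X)+h_P(Y)\ge h_P(X\otimes_PY)$ and $0\ge h_P(I_P)$; (3) $h_P(X\circ f)=h_Q(X)$ for $f:P\to Q$, $X\in Q/\mathsf{C}$; (4) $h_{P\otimes Q}(X\otimes Y)=h_P(X)+h_Q(Y)$ for $X\in P/\mathsf{C}$, $Y\in Q/\mathsf{C}$, and $h_I(I_I)=0$. The corresponding baseless $\mathsf{V}$-entropy is $H:\mathsf{C}\to W$, $H(P)=h_P(\mathrm{id}_P)$ (so $h_P(X)=H(A)$ for $X:P\to A$). A baseless $\mathsf{V}$-entropy $H$ into $W$ is universal if for every baseless $\mathsf{V}$-entropy $H'$ into $W'\in\mathsf{V}$ there is a unique morphism $t:W\to W'$ in $\mathsf{V}$ with $H'=t\circ H$. *)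

theory Defs
  imports "HOL-Probability.Probability" "HOL-Library.Product_Order"
begin

section \<open>Integrally closed ordered abelian groups and ordered rational vector spaces\<close>

text \<open>The \<open>n\<close>-fold multiple \<open>n x\<close> is written as a constant sum of \<open>n\<close> terms.\<close>

class ic_ordered_ab_group_add = ordered_ab_group_add +
  assumes integrally_closed: "(\<And>n::nat. n \<ge> 1 \<Longrightarrow> (\<Sum>i<n. x) \<le> y) \<Longrightarrow> x \<le> 0"

class scaleQ =
  fixes scaleQ :: "rat \<Rightarrow> 'a \<Rightarrow> 'a"  (infixr "*\<^sub>Q" 75)

class ic_ordered_rat_vector = ic_ordered_ab_group_add + scaleQ +
  assumes scaleQ_add_right: "a *\<^sub>Q (x + y) = a *\<^sub>Q x + a *\<^sub>Q y"
    and scaleQ_add_left: "(a + b) *\<^sub>Q x = a *\<^sub>Q x + b *\<^sub>Q x"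
    and scaleQ_scaleQ: "a *\<^sub>Q (b *\<^sub>Q x) = (a * b) *\<^sub>Q x"
    and scaleQ_one: "1 *\<^sub>Q x = x"
    and scaleQ_left_mono: "x \<ge> y \<Longrightarrow> a \<ge> 0 \<Longrightarrow> a *\<^sub>Q x \<ge> a *\<^sub>Q y"

lemma vector_space_scaleQ: "vector_space (scaleQ :: rat \<Rightarrow> 'a::ic_ordered_rat_vector \<Rightarrow> 'a)"
  by unfold_locales
     (simp_all add: scaleQ_add_right scaleQ_add_left scaleQ_scaleQ scaleQ_one)

definition ordered_group_hom :: "('w::ordered_ab_group_add \<Rightarrow> 'v::ordered_ab_group_add) \<Rightarrow> bool" where
  "ordered_group_hom t \<longleftrightarrow> Modules.additive t \<and> mono t"

definition ordered_linear_map :: "('w::ic_ordered_rat_vector \<Rightarrow> 'v::ic_ordered_rat_vector) \<Rightarrow> bool" where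
  "ordered_linear_map t \<longleftrightarrow> Vector_Spaces.linear scaleQ scaleQ t \<and> mono t"


section \<open>The category of finite probability spaces\<close>

text \<open>
  A universe of points that contains every element of an arbitrary type \<open>'a\<close>, is infinite
  whatever \<open>'a\<close> is, and is closed under formation of ordered pairs, so that finite
  distributions on it are closed under products.
\<close>

datatype 'a point = Star | Atom 'a | Tup "'a point" "'a point"

text \<open>
  A strictly positive mass function on a finite set is a \<open>pmf\<close> with finite support: the
  underlying set is \<open>set_pmf P\<close>.
\<close>

definition FinProb :: "'a point pmf set" where
  "FinProb = {P. finite (set_pmf P)}"

text \<open>Morphisms are functions on the support only, hence extensional.\<close>

definition FinProb_hom :: "'a point pmf \<Rightarrow> 'a point pmf \<Rightarrow> ('a point \<Rightarrow> 'a point) set" where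
  "FinProb_hom P Q = {f \<in> set_pmf P \<rightarrow>\<^sub>E set_pmf Q.
     \<forall>y\<in>set_pmf Q. pmf Q y = (\<Sum>x\<in>{x\<in>set_pmf P. f x = y}. pmf P x)}"

definition id_hom :: "'a point pmf \<Rightarrow> 'a point \<Rightarrow> 'a point" where
  "id_hom P = restrict (\<lambda>x. x) (set_pmf P)"

text \<open>\<open>comp_hom P g f\<close> is the composite of \<open>f : P \<rightarrow> Q\<close> with \<open>g : Q \<rightarrow> R\<close>.\<close>

definition comp_hom ::
  "'a point pmf \<Rightarrow> ('a point \<Rightarrow> 'a point) \<Rightarrow> ('a point \<Rightarrow> 'a point) \<Rightarrow> 'a point \<Rightarrow> 'a point" where
  "comp_hom P g f = compose (set_pmf P) g f"

definition tensor_obj :: "'a point pmf \<Rightarrow> 'a point pmf \<Rightarrow> 'a point pmf"  (infixr "\<otimes>\<^sub>o" 70) where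
  "P \<otimes>\<^sub>o Q = map_pmf (\<lambda>(x, y). Tup x y) (pair_pmf P Q)"

definition tensor_hom ::
  "'a point pmf \<Rightarrow> 'a point pmf \<Rightarrow> ('a point \<Rightarrow> 'a point) \<Rightarrow> ('a point \<Rightarrow> 'a point)
     \<Rightarrow> 'a point \<Rightarrow> 'a point" where
  "tensor_hom P Q X Y = restrict
     (\<lambda>z. case z of Tup x y \<Rightarrow> Tup (X x) (Y y) | _ \<Rightarrow> undefined) (set_pmf (P \<otimes>\<^sub>o Q))"

definition unit_obj :: "'a point pmf" where
  "unit_obj = return_pmf Star"


text \<open>
  An object of the under category of \<open>P\<close> is given by its codomain \<open>A\<close> and
  a morphism \<open>X : P \<rightarrow> A\<close>.
\<close>

definition under_hom ::
  "'a point pmf \<Rightarrow> 'a point pmf \<Rightarrow> ('a point \<Rightarrow> 'a point)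
     \<Rightarrow> 'a point pmf \<Rightarrow> ('a point \<Rightarrow> 'a point) \<Rightarrow> ('a point \<Rightarrow> 'a point) set" where
  "under_hom P A X A' X' = {f \<in> FinProb_hom A A'. comp_hom P f X = X'}"

definition joint_hom ::
  "'a point pmf \<Rightarrow> ('a point \<Rightarrow> 'a point) \<Rightarrow> ('a point \<Rightarrow> 'a point) \<Rightarrow> 'a point \<Rightarrow> 'a point" where
  "joint_hom P X Y = restrict (\<lambda>x. Tup (X x) (Y x)) (set_pmf P)"

definition joint_obj ::
  "'a point pmf \<Rightarrow> ('a point \<Rightarrow> 'a point) \<Rightarrow> ('a point \<Rightarrow> 'a point) \<Rightarrow> 'a point pmf" where
  "joint_obj P X Y = map_pmf (joint_hom P X Y) P"

definition unit_hom :: "'a point pmf \<Rightarrow> 'a point \<Rightarrow> 'a point" where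
  "unit_hom P = restrict (\<lambda>_. Star) (set_pmf P)"


section \<open>Entropies\<close>

text \<open>
  \<open>h P A X\<close> is the value of the component at \<open>P\<close> on the object \<open>X : P \<rightarrow> A\<close>.
  Only arguments with \<open>P, A \<in> FinProb\<close> and \<open>X \<in> FinProb_hom P A\<close> are meaningful.
\<close>

definition entropy_on_FinProb ::
  "('a point pmf \<Rightarrow> 'a point pmf \<Rightarrow> ('a point \<Rightarrow> 'a point) \<Rightarrow> 'w::ordered_comm_monoid_add) \<Rightarrow> bool" where
  "entropy_on_FinProb h \<longleftrightarrow>
     (\<forall>P\<in>FinProb. \<forall>A\<in>FinProb. \<forall>A'\<in>FinProb. \<forall>X\<in>FinProb_hom P A. \<forall>X'\<in>FinProb_hom P A'.
        under_hom P A X A' X' \<noteq> {} \<longrightarrow> h P A X \<ge> h P A' X') \<and>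
     (\<forall>P\<in>FinProb. \<forall>A\<in>FinProb. \<forall>B\<in>FinProb. \<forall>X\<in>FinProb_hom P A. \<forall>Y\<in>FinProb_hom P B.
        h P A X + h P B Y \<ge> h P (joint_obj P X Y) (joint_hom P X Y)) \<and>
     (\<forall>P\<in>FinProb. 0 \<ge> h P unit_obj (unit_hom P)) \<and>
     (\<forall>P\<in>FinProb. \<forall>Q\<in>FinProb. \<forall>A\<in>FinProb. \<forall>f\<in>FinProb_hom P Q. \<forall>X\<in>FinProb_hom Q A.
        h P A (comp_hom P X f) = h Q A X) \<and>
     (\<forall>P\<in>FinProb. \<forall>Q\<in>FinProb. \<forall>A\<in>FinProb. \<forall>B\<in>FinProb. \<forall>X\<in>FinProb_hom P A. \<forall>Y\<in>FinProb_hom Q B.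
        h (P \<otimes>\<^sub>o Q) (A \<otimes>\<^sub>o B) (tensor_hom P Q X Y) = h P A X + h Q B Y) \<and>
     h unit_obj unit_obj (unit_hom unit_obj) = 0"

definition baseless_entropy :: "('a point pmf \<Rightarrow> 'w::ordered_comm_monoid_add) \<Rightarrow> bool" where
  "baseless_entropy H \<longleftrightarrow>
     (\<exists>h. entropy_on_FinProb h \<and> (\<forall>P\<in>FinProb. H P = h P P (id_hom P)))"

text \<open>
  Universality quantifies over all codomains, i.e. over types. The type argument is the
  codomain of the competing entropy; a universal entropy satisfies the predicate for every
  type of the given class.
\<close>

definition universal_IcOrdAb_entropy ::
  "'v::ic_ordered_ab_group_add itself \<Rightarrow> ('a point pmf \<Rightarrow> 'w::ic_ordered_ab_group_add) \<Rightarrow> bool" where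
  "universal_IcOrdAb_entropy _ H \<longleftrightarrow> baseless_entropy H \<and>
     (\<forall>H' :: 'a point pmf \<Rightarrow> 'v. baseless_entropy H' \<longrightarrow>
        (\<exists>!t. ordered_group_hom t \<and> (\<forall>P\<in>FinProb. H' P = t (H P))))"

definition universal_IcOrdVectQ_entropy ::
  "'v::ic_ordered_rat_vector itself \<Rightarrow> ('a point pmf \<Rightarrow> 'w::ic_ordered_rat_vector) \<Rightarrow> bool" where
  "universal_IcOrdVectQ_entropy _ H \<longleftrightarrow> baseless_entropy H \<and>
     (\<forall>H' :: 'a point pmf \<Rightarrow> 'v. baseless_entropy H' \<longrightarrow>
        (\<exists>!t. ordered_linear_map t \<and> (\<forall>P\<in>FinProb. H' P = t (H P))))"

definition H0 :: "'a point pmf \<Rightarrow> real" where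
  "H0 P = ln (real (card (set_pmf P)))"

definition H1 :: "'a point pmf \<Rightarrow> real" where
  "H1 P = - (\<Sum>x\<in>set_pmf P. pmf P x * ln (pmf P x))"


section \<open>The codomains\<close>

lemma real_integrally_closed:
  fixes x y :: real
  assumes "\<And>n::nat. n \<ge> 1 \<Longrightarrow> real n * x \<le> y"
  shows "x \<le> 0"
proof (rule ccontr)
  assume "\<not> x \<le> 0"
  then obtain n :: nat where n: "y < real n * x"
    using reals_Archimedean3[of x] by auto
  have "real n * x \<le> real (Suc n) * x"
    using \<open>\<not> x \<le> 0\<close> by (simp add: mult_right_mono)
  then show False using n assms[of "Suc n"] by linarith
qed

instance real :: ic_ordered_ab_group_add
proof
  fix x y :: real
  assume "\<And>n::nat. n \<ge> 1 \<Longrightarrow> (\<Sum>i<n. x) \<le> y"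
  then show "x \<le> 0" by (intro real_integrally_closed[of x y]) simp
qed

instantiation real :: ic_ordered_rat_vector
begin
definition scaleQ_real :: "rat \<Rightarrow> real \<Rightarrow> real" where
  "a *\<^sub>Q x = of_rat a * x" for x :: real
instance
  by standard (simp_all add: scaleQ_real_def algebra_simps of_rat_add of_rat_mult mult_right_mono)
end

text \<open>
  The intermediate classes have to be instantiated one by one, because the library already has
  arities of \<open>prod\<close> for them that are restricted to \<open>ordered_euclidean_space\<close>.
\<close>

instance prod :: (ordered_ab_group_add, ordered_ab_group_add) ordered_ab_semigroup_add
  by standard (auto simp: less_eq_prod_def)
instance prod :: (ordered_ab_group_add, ordered_ab_group_add) ordered_comm_monoid_add
  by standard (auto simp: less_eq_prod_def)
instance prod :: (ordered_ab_group_add, ordered_ab_group_add) ordered_cancel_ab_semigroup_add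
  by standard (auto simp: less_eq_prod_def)
instance prod :: (ordered_ab_group_add, ordered_ab_group_add) ordered_cancel_comm_monoid_add
  by standard (auto simp: less_eq_prod_def)
instance prod :: (ordered_ab_group_add, ordered_ab_group_add) ordered_ab_semigroup_add_imp_le
  by standard (auto simp: less_eq_prod_def)
instance prod :: (ordered_ab_group_add, ordered_ab_group_add) ordered_ab_semigroup_monoid_add_imp_le
  by standard (auto simp: less_eq_prod_def)
instance prod :: (ordered_ab_group_add, ordered_ab_group_add) ordered_ab_group_add
  by standard (auto simp: less_eq_prod_def)

instance prod :: (ic_ordered_ab_group_add, ic_ordered_ab_group_add) ic_ordered_ab_group_add
proof
  fix x y :: "'a \<times> 'b"
  assume le: "\<And>n::nat. n \<ge> 1 \<Longrightarrow> (\<Sum>i<n. x) \<le> y"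
  have "fst x \<le> 0"
  proof (rule integrally_closed)
    fix n :: nat assume "n \<ge> 1"
    from le[OF this] show "(\<Sum>i<n. fst x) \<le> fst y"
      by (simp add: less_eq_prod_def fst_sum)
  qed
  moreover have "snd x \<le> 0"
  proof (rule integrally_closed)
    fix n :: nat assume "n \<ge> 1"
    from le[OF this] show "(\<Sum>i<n. snd x) \<le> snd y"
      by (simp add: less_eq_prod_def snd_sum)
  qed
  ultimately show "x \<le> 0" by (simp add: less_eq_prod_def)
qed

instantiation prod :: (ic_ordered_rat_vector, ic_ordered_rat_vector) ic_ordered_rat_vector
begin
definition scaleQ_prod :: "rat \<Rightarrow> 'a \<times> 'b \<Rightarrow> 'a \<times> 'b" where
  "a *\<^sub>Q x = (a *\<^sub>Q fst x, a *\<^sub>Q snd x)" for x :: "'a \<times> 'b"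
instance
  by standard (auto simp: scaleQ_prod_def less_eq_prod_def scaleQ_add_right scaleQ_add_left
      scaleQ_scaleQ scaleQ_one scaleQ_left_mono)
end

typedef log_rat = "{ln (of_rat q) :: real | q :: rat. q > 0}"
  by (auto intro: exI[of _ 1])

setup_lifting type_definition_log_rat

instantiation log_rat :: ordered_ab_group_add
begin

lift_definition zero_log_rat :: log_rat is "0 :: real"
  by (rule exI[of _ 1]) simp

lift_definition plus_log_rat :: "log_rat \<Rightarrow> log_rat \<Rightarrow> log_rat" is "(+) :: real \<Rightarrow> real \<Rightarrow> real"
proof -
  fix x y :: real
  assume "\<exists>q. x = ln (of_rat q) \<and> 0 < q" "\<exists>q. y = ln (of_rat q) \<and> 0 < q"
  then obtain p q :: rat where "x = ln (of_rat p)" "0 < p" "y = ln (of_rat q)" "0 < q" by auto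
  then show "\<exists>q. x + y = ln (of_rat q) \<and> 0 < q"
    by (intro exI[of _ "p * q"]) (simp add: of_rat_mult ln_mult)
qed

lift_definition uminus_log_rat :: "log_rat \<Rightarrow> log_rat" is "uminus :: real \<Rightarrow> real"
proof -
  fix x :: real
  assume "\<exists>q. x = ln (of_rat q) \<and> 0 < q"
  then obtain p :: rat where "x = ln (of_rat p)" "0 < p" by auto
  then show "\<exists>q. - x = ln (of_rat q) \<and> 0 < q"
    by (intro exI[of _ "inverse p"]) (simp add: of_rat_inverse ln_inverse)
qed

definition minus_log_rat :: "log_rat \<Rightarrow> log_rat \<Rightarrow> log_rat" where
  "x - y = x + (- y)" for x y :: log_rat

lift_definition less_eq_log_rat :: "log_rat \<Rightarrow> log_rat \<Rightarrow> bool" is "(\<le>) :: real \<Rightarrow> real \<Rightarrow> bool" .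

lift_definition less_log_rat :: "log_rat \<Rightarrow> log_rat \<Rightarrow> bool" is "(<) :: real \<Rightarrow> real \<Rightarrow> bool" .

instance
proof
  fix a b c :: log_rat
  show "a + b + c = a + (b + c)" by transfer simp
  show "a + b = b + a" by transfer simp
  show "0 + a = a" by transfer simp
  show "- a + a = 0" by transfer simp
  show "a - b = a + - b" by (rule minus_log_rat_def)
  show "(a < b) = (a \<le> b \<and> \<not> b \<le> a)" by transfer auto
  show "a \<le> a" by transfer simp
  show "a \<le> b \<Longrightarrow> b \<le> c \<Longrightarrow> a \<le> c" by transfer simp
  show "a \<le> b \<Longrightarrow> b \<le> a \<Longrightarrow> a = b" by transfer simp
  show "a \<le> b \<Longrightarrow> c + a \<le> c + b" by transfer simp
qed

end

instance log_rat :: ic_ordered_ab_group_add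
proof
  fix x y :: log_rat
  assume le: "\<And>n::nat. n \<ge> 1 \<Longrightarrow> (\<Sum>i<n. x) \<le> y"
  have sum: "Rep_log_rat (\<Sum>i<n. x) = real n * Rep_log_rat x" for n :: nat
    by (induction n) (simp_all add: zero_log_rat.rep_eq plus_log_rat.rep_eq algebra_simps)
  have "Rep_log_rat x \<le> 0"
    by (rule real_integrally_closed[of _ "Rep_log_rat y"])
       (use le in \<open>simp add: less_eq_log_rat.rep_eq sum\<close>)
  then show "x \<le> 0" by (simp add: less_eq_log_rat.rep_eq zero_log_rat.rep_eq)
qed

typedef rat_log_rat = "{of_rat a * ln (of_rat b) :: real | (a :: rat) (b :: rat). b > 0}"
  by (auto intro: exI[of _ 1])

setup_lifting type_definition_rat_log_rat

text \<open>Closure under addition: \<open>(m/n) log b + (k/l) log c = (1/(n l)) log (b^(m l) c^(k n))\<close>.\<close>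

lemma rat_log_rat_add:
  fixes a a' b b' :: rat
  assumes "b > 0" "b' > 0"
  shows "\<exists>(c::rat) (d::rat). of_rat a * ln (of_rat b) + of_rat a' * ln (of_rat b') =
    (of_rat c * ln (of_rat d) :: real) \<and> d > 0"
proof -
  obtain m n where a: "a = of_int m / of_int n" "n > 0"
    by (metis quotient_of_denom_pos quotient_of_div surj_pair)
  obtain k l where a': "a' = of_int k / of_int l" "l > 0"
    by (metis quotient_of_denom_pos quotient_of_div surj_pair)
  have ra: "(of_rat a :: real) = of_int m / of_int n" using a by (simp add: of_rat_divide)
  have ra': "(of_rat a' :: real) = of_int k / of_int l" using a' by (simp add: of_rat_divide)
  define d where "d = b powi (m * l) * b' powi (k * n)"
  have d: "d > 0" using assms by (simp add: d_def zero_less_power_int)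
  have pw: "ln (of_rat (c powi i) :: real) = of_int i * ln (of_rat c)" if "c > 0" for c :: rat and i
    using that by (simp add: power_int_def of_rat_power of_rat_inverse ln_realpow ln_inverse
        of_nat_nat power_inverse)
  have "ln (of_rat d :: real) = of_int (m * l) * ln (of_rat b) + of_int (k * n) * ln (of_rat b')"
    unfolding d_def of_rat_mult using assms
    by (subst ln_mult) (auto simp: pw[symmetric] zero_less_power_int simp del: of_int_mult)
  then have "of_rat a * ln (of_rat b) + of_rat a' * ln (of_rat b') =
      (of_rat (1 / (of_int n * of_int l)) * ln (of_rat d) :: real)"
    unfolding ra ra' using a(2) a'(2) by (simp add: of_rat_divide of_rat_mult field_simps)
  with d show ?thesis by blast
qed

instantiation rat_log_rat :: "{ordered_ab_group_add, scaleQ}"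
begin

lift_definition zero_rat_log_rat :: rat_log_rat is "0 :: real"
  by (rule exI[of _ 0], rule exI[of _ 1]) simp

lift_definition plus_rat_log_rat :: "rat_log_rat \<Rightarrow> rat_log_rat \<Rightarrow> rat_log_rat"
  is "(+) :: real \<Rightarrow> real \<Rightarrow> real"
  using rat_log_rat_add by blast

lift_definition scaleQ_rat_log_rat :: "rat \<Rightarrow> rat_log_rat \<Rightarrow> rat_log_rat"
  is "\<lambda>a x. of_rat a * x :: real"
  by (metis mult.assoc of_rat_mult)

definition uminus_rat_log_rat :: "rat_log_rat \<Rightarrow> rat_log_rat" where
  "- x = (- 1) *\<^sub>Q x" for x :: rat_log_rat

definition minus_rat_log_rat :: "rat_log_rat \<Rightarrow> rat_log_rat \<Rightarrow> rat_log_rat" where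
  "x - y = x + (- y)" for x y :: rat_log_rat

lift_definition less_eq_rat_log_rat :: "rat_log_rat \<Rightarrow> rat_log_rat \<Rightarrow> bool"
  is "(\<le>) :: real \<Rightarrow> real \<Rightarrow> bool" .

lift_definition less_rat_log_rat :: "rat_log_rat \<Rightarrow> rat_log_rat \<Rightarrow> bool"
  is "(<) :: real \<Rightarrow> real \<Rightarrow> bool" .

instance
proof
  fix a b c :: rat_log_rat
  show "a + b + c = a + (b + c)" by transfer simp
  show "a + b = b + a" by transfer simp
  show "0 + a = a" by transfer simp
  show "- a + a = 0" unfolding uminus_rat_log_rat_def by transfer (simp add: of_rat_minus)
  show "a - b = a + - b" by (rule minus_rat_log_rat_def)
  show "(a < b) = (a \<le> b \<and> \<not> b \<le> a)" by transfer auto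
  show "a \<le> a" by transfer simp
  show "a \<le> b \<Longrightarrow> b \<le> c \<Longrightarrow> a \<le> c" by transfer simp
  show "a \<le> b \<Longrightarrow> b \<le> a \<Longrightarrow> a = b" by transfer simp
  show "a \<le> b \<Longrightarrow> c + a \<le> c + b" by transfer simp
qed

end

instance rat_log_rat :: ic_ordered_ab_group_add
proof
  fix x y :: rat_log_rat
  assume le: "\<And>n::nat. n \<ge> 1 \<Longrightarrow> (\<Sum>i<n. x) \<le> y"
  have sum: "Rep_rat_log_rat (\<Sum>i<n. x) = real n * Rep_rat_log_rat x" for n :: nat
    by (induction n) (simp_all add: zero_rat_log_rat.rep_eq plus_rat_log_rat.rep_eq algebra_simps)
  have "Rep_rat_log_rat x \<le> 0"
    by (rule real_integrally_closed[of _ "Rep_rat_log_rat y"])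
       (use le in \<open>simp add: less_eq_rat_log_rat.rep_eq sum\<close>)
  then show "x \<le> 0" by (simp add: less_eq_rat_log_rat.rep_eq zero_rat_log_rat.rep_eq)
qed

instance rat_log_rat :: ic_ordered_rat_vector
proof
  fix x y :: rat_log_rat and r s :: rat
  show "r *\<^sub>Q (x + y) = r *\<^sub>Q x + r *\<^sub>Q y" by transfer (simp add: algebra_simps)
  show "(r + s) *\<^sub>Q x = r *\<^sub>Q x + s *\<^sub>Q x" by transfer (simp add: algebra_simps of_rat_add)
  show "r *\<^sub>Q (s *\<^sub>Q x) = (r * s) *\<^sub>Q x" by transfer (simp add: of_rat_mult)
  show "1 *\<^sub>Q x = x" by transfer simp
  show "y \<le> x \<Longrightarrow> 0 \<le> r \<Longrightarrow> r *\<^sub>Q y \<le> r *\<^sub>Q x" by transfer (simp add: mult_left_mono)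
qed

text \<open>\<open>H0\<close> takes values in both sets, so \<open>Abs_log_rat\<close> and \<open>Abs_rat_log_rat\<close> are meaningful on them.\<close>

lemma Rep_log_rat_H0:
  assumes "P \<in> FinProb"
  shows "Rep_log_rat (Abs_log_rat (H0 P)) = H0 P"
proof (rule Abs_log_rat_inverse)
  have "card (set_pmf P) > 0" using assms set_pmf_not_empty by (auto simp: FinProb_def card_gt_0_iff)
  then show "H0 P \<in> {ln (of_rat q) | q. q > 0}"
    by (auto simp: H0_def intro!: exI[of _ "of_nat (card (set_pmf P))"])
qed

lemma Rep_rat_log_rat_H0:
  assumes "P \<in> FinProb"
  shows "Rep_rat_log_rat (Abs_rat_log_rat (H0 P)) = H0 P"
proof (rule Abs_rat_log_rat_inverse)
  have "card (set_pmf P) > 0" using assms set_pmf_not_empty by (auto simp: FinProb_def card_gt_0_iff)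
  then show "H0 P \<in> {of_rat a * ln (of_rat b) | a b. b > 0}"
    by (simp add: H0_def) (rule exI[of _ 1], rule exI[of _ "of_nat (card (set_pmf P))"], simp)
qed

end

theory Submission
  imports Defs
begin

text \<open>
  Everything rests on one comparison: if \<open>H0 Q \<le> H0 P\<close> and \<open>H1 Q \<le> H1 P\<close>, then \<open>H Q \<le> H P\<close> for every baseless
  entropy \<open>H\<close> with integrally closed values. Exchanging the \<open>R\<close>-part of a mixture \<open>t R + (1 - t) S\<close> with an
  independent sample shows that \<open>H\<close> is concave along segments, and that changing a part of mass \<open>1 / q\<close>,
  without changing its support, costs at most \<open>H U / q\<close>, where \<open>U\<close> is uniform on that part. In
  the tensor powers \<open>P\<^sup>N\<close> and \<open>Q\<^sup>N\<close> of distributions with \<open>H1 Q < c < H1 P\<close> one may therefore change the atypical parts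
  so that all atoms of \<open>P\<^sup>N\<close> have mass at most \<open>exp (- N c)\<close>, while \<open>Q\<^sup>N\<close> is a mixture of an image of \<open>P\<^sup>N\<close>
  and a distribution whose atoms have mass at least \<open>exp (- N c)\<close>. The latter is a function of \<open>P\<^sup>N\<close> and one further bit.
  By Chebyshev's inequality the atypical mass is \<open>O(1 / N)\<close>, so the total error is bounded and integral closedness
  gives \<open>H Q \<le> H P\<close>. The homomorphism is then \<open>(H0, H1) P - (H0, H1) Q \<mapsto> H P - H Q\<close>.
\<close>

section \<open>Baseless entropies\<close>

text \<open>No continuity of \<open>H\<close> is available, and its values cannot be divided; a cost
  of \<open>1 / q\<close> times something is therefore stated after multiplication by
  \<open>q\<close>. Supports have to be kept because the Hartley entropy is itself an entropy: it
  jumps when a tiny mass moves to new points. The error stays bounded because two rates match. The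
  variance of the information content of an N-fold product is linear in N while the squared
  deviation is quadratic, so \<open>N = C q\<close> pushes the atypical mass below
  \<open>1 / (2 q)\<close>. A uniform distribution on \<open>k ^ N\<close> points is worth N times a
  constant, of which a share \<open>1 / q\<close> is paid, that is \<open>C\<close> times the
  constant, whatever \<open>q\<close> is. The strict gap between the Shannon entropies makes room
  for the threshold; equality is reached by granting one extra fair bit to ever higher powers.
  Universality also needs that differences of values exhaust the codomain, up to positive multiples
  in the rational case. Uniform distributions supply the logarithms of rationals, and binary
  distributions vary the Shannon entropy continuously at fixed Hartley entropy, which is why all
  real numbers appear in the second factor.\<close>

lemma pmf_map_finite:
  assumes "finite A" "set_pmf p \<subseteq> A"
  shows "pmf (map_pmf f p) y = (\<Sum>x\<in>{x\<in>A. f x = y}. pmf p x)"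
proof -
  have "pmf (map_pmf f p) y = measure p (f -` {y} \<inter> set_pmf p)"
    by (simp add: pmf_map measure_Int_set_pmf)
  also have "f -` {y} \<inter> set_pmf p = {x\<in>A. f x = y} \<inter> set_pmf p" using assms(2) by auto
  also have "measure p \<dots> = measure p {x\<in>A. f x = y}" by (rule measure_Int_set_pmf)
  finally show ?thesis using assms(1) by (simp add: measure_measure_pmf_finite)
qed

lemma FinProb_hom_imp_map_pmf:
  assumes "X \<in> FinProb_hom P A" "P \<in> FinProb"
  shows "map_pmf X P = A"
proof (rule pmf_eqI)
  fix y
  have fin: "finite (set_pmf P)" using assms by (simp add: FinProb_def)
  have eq: "pmf (map_pmf X P) y = (\<Sum>x\<in>{x\<in>set_pmf P. X x = y}. pmf P x)"
    by (rule pmf_map_finite[OF fin order.refl])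
  show "pmf (map_pmf X P) y = pmf A y"
  proof (cases "y \<in> set_pmf A")
    case True
    with assms show ?thesis by (simp add: FinProb_hom_def eq)
  next
    case False
    with assms have "{x\<in>set_pmf P. X x = y} = {}" by (auto simp: FinProb_hom_def)
    then have "pmf (map_pmf X P) y = 0" using eq by (metis sum.empty)
    moreover have "pmf A y = 0" using False by (simp add: set_pmf_iff)
    ultimately show ?thesis by simp
  qed
qed

lemma restrict_in_FinProb_hom:
  assumes "P \<in> FinProb"
  shows "restrict f (set_pmf P) \<in> FinProb_hom P (map_pmf f P)"
proof -
  have fin: "finite (set_pmf P)" using assms by (simp add: FinProb_def)
  have "pmf (map_pmf f P) y = (\<Sum>x\<in>{x\<in>set_pmf P. restrict f (set_pmf P) x = y}. pmf P x)" for y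
  proof -
    have "{x\<in>set_pmf P. restrict f (set_pmf P) x = y} = {x\<in>set_pmf P. f x = y}" by auto
    then show ?thesis by (simp add: pmf_map_finite[OF fin order.refl])
  qed
  then show ?thesis by (auto simp: FinProb_hom_def)
qed

lemma map_pmf_restrict: "map_pmf (restrict f (set_pmf P)) P = map_pmf f P"
  by (rule map_pmf_cong) auto

lemma map_pmf_in_FinProb [simp]: "P \<in> FinProb \<Longrightarrow> map_pmf f P \<in> FinProb"
  by (simp add: FinProb_def)

lemma tensor_in_FinProb [simp]: "P \<in> FinProb \<Longrightarrow> Q \<in> FinProb \<Longrightarrow> P \<otimes>\<^sub>o Q \<in> FinProb"
  by (simp add: FinProb_def tensor_obj_def)

lemma unit_in_FinProb [simp]: "unit_obj \<in> FinProb"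
  by (simp add: FinProb_def unit_obj_def)

text \<open>What an entropy becomes once its value on \<open>X : P \<rightarrow> A\<close> is known
  to depend on \<open>A\<close> alone. A measure-preserving map forces its codomain to be the
  pushforward, so total functions can replace extensional morphisms.\<close>

locale point_entropy =
  fixes H :: "'a point pmf \<Rightarrow> 'w::ordered_comm_monoid_add"
  assumes mono: "P \<in> FinProb \<Longrightarrow> H (map_pmf f P) \<le> H P"
    and subadditive: "P \<in> FinProb \<Longrightarrow>
      H (map_pmf (\<lambda>x. Tup (X x) (Y x)) P) \<le> H (map_pmf X P) + H (map_pmf Y P)"
    and tensor: "P \<in> FinProb \<Longrightarrow> Q \<in> FinProb \<Longrightarrow> H (P \<otimes>\<^sub>o Q) = H P + H Q"
    and unit: "H unit_obj = 0"

lemma joint_obj_eq: "joint_obj P X Y = map_pmf (\<lambda>x. Tup (X x) (Y x)) P"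
  by (simp add: joint_obj_def joint_hom_def map_pmf_restrict)

lemma id_hom_in_FinProb_hom: "P \<in> FinProb \<Longrightarrow> id_hom P \<in> FinProb_hom P P"
  using restrict_in_FinProb_hom[of P "\<lambda>x. x"] by (simp add: id_hom_def)

lemma baseless_entropy_iff: "baseless_entropy H \<longleftrightarrow> point_entropy H"
proof
  assume "baseless_entropy H"
  then obtain h where h: "entropy_on_FinProb h" and H: "\<And>P. P \<in> FinProb \<Longrightarrow> H P = h P P (id_hom P)"
    by (auto simp: baseless_entropy_def)
  note h' = h[unfolded entropy_on_FinProb_def]
  note h_mono = h'[THEN conjunct1, rule_format]
    and h_sub = h'[THEN conjunct2, THEN conjunct1, rule_format]
    and h_natural = h'[THEN conjunct2, THEN conjunct2, THEN conjunct2, THEN conjunct1, rule_format]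
    and h_tensor = h'[THEN conjunct2, THEN conjunct2, THEN conjunct2, THEN conjunct2, THEN conjunct1,
      rule_format]
    and h_unit = h'[THEN conjunct2, THEN conjunct2, THEN conjunct2, THEN conjunct2, THEN conjunct2]
  have h_eq: "h P A X = H A" if "P \<in> FinProb" "X \<in> FinProb_hom P A" for P A X
  proof -
    have A: "A \<in> FinProb" using FinProb_hom_imp_map_pmf that map_pmf_in_FinProb by metis
    \<comment> \<open>Naturality along \<open>X\<close>, applied to the identity of
      \<open>A\<close>: the base \<open>P\<close> drops out of the value.\<close>
    have "h P A (comp_hom P (id_hom A) X) = h A A (id_hom A)"
      using that A id_hom_in_FinProb_hom[OF A] by (intro h_natural)
    moreover have "comp_hom P (id_hom A) X = X"
      using that(2) by (auto simp: comp_hom_def compose_def id_hom_def FinProb_hom_def fun_eq_iff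
        PiE_def extensional_def Pi_def)
    ultimately show ?thesis using H A by simp
  qed
  show "point_entropy H"
  proof
    fix P :: "'a point pmf" and f :: "'a point \<Rightarrow> 'a point" assume P: "P \<in> FinProb"
    let ?f = "restrict f (set_pmf P)"
    have f: "?f \<in> FinProb_hom P (map_pmf f P)" by (rule restrict_in_FinProb_hom[OF P])
    have "comp_hom P ?f (id_hom P) = ?f"
      by (auto simp: comp_hom_def compose_def id_hom_def)
    then have "under_hom P P (id_hom P) (map_pmf f P) ?f \<noteq> {}"
      using f by (auto simp: under_hom_def)
    then have "h P (map_pmf f P) ?f \<le> h P P (id_hom P)"
      by (rule h_mono[OF P P map_pmf_in_FinProb[OF P] id_hom_in_FinProb_hom[OF P] f])
    then show "H (map_pmf f P) \<le> H P" using h_eq[OF P f] H[OF P] by simp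
  next
    fix P :: "'a point pmf" and X Y :: "'a point \<Rightarrow> 'a point" assume P: "P \<in> FinProb"
    let ?X = "restrict X (set_pmf P)" and ?Y = "restrict Y (set_pmf P)"
    let ?J = "joint_hom P ?X ?Y"
    have X: "?X \<in> FinProb_hom P (map_pmf X P)" and Y: "?Y \<in> FinProb_hom P (map_pmf Y P)"
      by (rule restrict_in_FinProb_hom[OF P])+
    have J: "?J \<in> FinProb_hom P (joint_obj P ?X ?Y)"
      unfolding joint_hom_def joint_obj_eq by (rule restrict_in_FinProb_hom[OF P])
    have "h P (joint_obj P ?X ?Y) ?J \<le> h P (map_pmf X P) ?X + h P (map_pmf Y P) ?Y"
      by (rule h_sub[OF P map_pmf_in_FinProb[OF P] map_pmf_in_FinProb[OF P] X Y])
    moreover have "joint_obj P ?X ?Y = map_pmf (\<lambda>x. Tup (X x) (Y x)) P"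
      unfolding joint_obj_eq by (rule map_pmf_cong) auto
    ultimately show "H (map_pmf (\<lambda>x. Tup (X x) (Y x)) P) \<le> H (map_pmf X P) + H (map_pmf Y P)"
      using h_eq[OF P X] h_eq[OF P Y] h_eq[OF P J] by simp
  next
    fix P Q :: "'a point pmf" assume P: "P \<in> FinProb" and Q: "Q \<in> FinProb"
    have "h (P \<otimes>\<^sub>o Q) (P \<otimes>\<^sub>o Q) (tensor_hom P Q (id_hom P) (id_hom Q))
        = h P P (id_hom P) + h Q Q (id_hom Q)"
      by (rule h_tensor[OF P Q P Q id_hom_in_FinProb_hom[OF P] id_hom_in_FinProb_hom[OF Q]])
    moreover have "tensor_hom P Q (id_hom P) (id_hom Q) = id_hom (P \<otimes>\<^sub>o Q)"
      by (auto simp: tensor_hom_def id_hom_def tensor_obj_def fun_eq_iff restrict_def)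
    ultimately show "H (P \<otimes>\<^sub>o Q) = H P + H Q" using H P Q by simp
  next
    have "unit_hom unit_obj \<in> FinProb_hom unit_obj unit_obj"
      using restrict_in_FinProb_hom[of unit_obj "\<lambda>_. Star"]
      by (simp add: unit_hom_def) (simp add: unit_obj_def)
    then show "H unit_obj = 0"
      using h_unit h_eq[OF unit_in_FinProb] by metis
  qed
next
  assume "point_entropy H"
  then interpret point_entropy H .
  have "entropy_on_FinProb (\<lambda>P A X. H A)"
    unfolding entropy_on_FinProb_def
  proof (intro conjI ballI impI)
    fix P A A' :: "'a point pmf" and X X'
    assume A: "A \<in> FinProb" and ne: "under_hom P A X A' X' \<noteq> {}"
    then obtain f where "f \<in> FinProb_hom A A'" by (auto simp: under_hom_def)
    then have "A' = map_pmf f A" using FinProb_hom_imp_map_pmf A by metis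
    then show "H A' \<le> H A" using mono A by simp
  next
    fix P A B :: "'a point pmf" and X Y
    assume P: "P \<in> FinProb" and XY: "X \<in> FinProb_hom P A" "Y \<in> FinProb_hom P B"
    then have "A = map_pmf X P" "B = map_pmf Y P" by (auto simp: FinProb_hom_imp_map_pmf)
    then show "H (joint_obj P X Y) \<le> H A + H B" using subadditive[OF P] by (simp add: joint_obj_eq)
  qed (auto simp: unit tensor)
  then show "baseless_entropy H" unfolding baseless_entropy_def by auto
qed

section \<open>Entropy of distributions on arbitrary types\<close>

text \<open>An infinite supply of points that exists for every \<open>'a\<close>, built without
  atoms.\<close>

primrec tuple_code :: "nat \<Rightarrow> 'a point" where
  "tuple_code 0 = Star"
| "tuple_code (Suc n) = Tup Star (tuple_code n)"

lemma inj_tuple_code: "inj tuple_code"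
proof (rule injI)
  fix m n :: nat
  show "tuple_code m = (tuple_code n :: 'a point) \<Longrightarrow> m = n"
  proof (induction m arbitrary: n)
    case 0 then show ?case by (cases n) auto
  next
    case (Suc m) then show ?case by (cases n) auto
  qed
qed

definition to_point :: "'b pmf \<Rightarrow> 'b \<Rightarrow> 'a point" where
  "to_point p x = tuple_code (to_nat_on (set_pmf p) x)"

lemma inj_on_to_point: "inj_on (to_point p) (set_pmf p)"
  unfolding to_point_def
  by (intro inj_onI, drule injD[OF inj_tuple_code]) (auto simp: inj_on_def to_nat_on_inj)

text \<open>Carries \<open>H\<close> to distributions on sums, products and numbers, where the
  constructions live. For finite supports the numbering behind \<open>to_point\<close> is immaterial
  by \<open>ent_eq\<close>.\<close>

definition ent :: "('a point pmf \<Rightarrow> 'w) \<Rightarrow> 'b pmf \<Rightarrow> 'w" where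
  "ent H p = H (map_pmf (to_point p) p)"

lemma map_pmf_inv_into:
  assumes "inj_on e (set_pmf p)"
  shows "map_pmf (\<lambda>z. g (inv_into (set_pmf p) e z)) (map_pmf e p) = map_pmf g p"
  unfolding map_pmf_comp by (rule map_pmf_cong) (auto simp: assms)

context point_entropy
begin

text \<open>Two injective encodings of \<open>p\<close> are functions of each other, so
  \<open>mono\<close> applies in both directions.\<close>

lemma ent_eq:
  assumes "finite (set_pmf p)" "inj_on e (set_pmf p)"
  shows "ent H p = H (map_pmf e p)"
proof -
  have fin: "map_pmf f p \<in> FinProb" for f :: "_ \<Rightarrow> 'a point" using assms by (simp add: FinProb_def)
  have "H (map_pmf e' p) \<le> H (map_pmf e p)" if "inj_on e (set_pmf p)" for e e' :: "_ \<Rightarrow> 'a point"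
    using mono[OF fin, of "\<lambda>z. e' (inv_into (set_pmf p) e z)" e] that by (simp only: map_pmf_inv_into)
  from this[of e "to_point p"] this[of "to_point p" e] show ?thesis
    using assms inj_on_to_point unfolding ent_def by (metis order.antisym)
qed

lemma ent_point: "P \<in> FinProb \<Longrightarrow> ent H P = H P"
  using ent_eq[of P id] by (simp add: FinProb_def)

lemma ent_map_le:
  assumes "finite (set_pmf p)"
  shows "ent H (map_pmf f p) \<le> ent H p"
proof -
  let ?e = "to_point p :: _ \<Rightarrow> 'a point"
  have "ent H (map_pmf f p) =
      H (map_pmf (\<lambda>z. to_point (map_pmf f p) (f (inv_into (set_pmf p) ?e z))) (map_pmf ?e p))"
    by (subst map_pmf_inv_into[OF inj_on_to_point]) (simp add: ent_def map_pmf_comp)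
  also have "\<dots> \<le> H (map_pmf ?e p)"
    using assms by (intro mono) (simp add: FinProb_def)
  finally show ?thesis by (simp add: ent_def)
qed

lemma ent_map_inj:
  assumes "finite (set_pmf p)" "inj_on f (set_pmf p)"
  shows "ent H (map_pmf f p) = ent H p"
proof (rule order.antisym)
  have "map_pmf (inv_into (set_pmf p) f) (map_pmf f p) = p"
    using map_pmf_inv_into[OF assms(2), of "\<lambda>x. x"] by simp
  then show "ent H p \<le> ent H (map_pmf f p)"
    using assms ent_map_le[of "map_pmf f p" "inv_into (set_pmf p) f"] by simp
qed (rule ent_map_le[OF assms(1)])

lemma ent_return: "ent H (return_pmf x) = 0"
proof -
  have "ent H (return_pmf x) = H (map_pmf (\<lambda>_. Star) (return_pmf x))"
    by (rule ent_eq) auto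
  then show ?thesis using unit by (simp add: unit_obj_def)
qed

lemma ent_nonneg: "finite (set_pmf p) \<Longrightarrow> 0 \<le> ent H p"
  using ent_map_le[of p "\<lambda>_. ()"] by (simp add: ent_return)

text \<open>The pair determines the outcome, so \<open>p\<close> is a relabelling of the joint
  distribution to which \<open>subadditive\<close> applies. \<open>ent_swap\<close>,
  \<open>ent_le_unif\<close> and \<open>exists_cheap_coupling\<close> each choose two functions that
  jointly recover the outcome.\<close>

lemma ent_le_add:
  assumes fin: "finite (set_pmf p)" and inj: "inj_on (\<lambda>x. (X x, Y x)) (set_pmf p)"
  shows "ent H p \<le> ent H (map_pmf X p) + ent H (map_pmf Y p)"
proof -
  let ?e = "to_point p :: _ \<Rightarrow> 'a point"
    and ?X = "to_point (map_pmf X p) :: _ \<Rightarrow> 'a point"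
    and ?Y = "to_point (map_pmf Y p) :: _ \<Rightarrow> 'a point"
  let ?i = "inv_into (set_pmf p) ?e"
  have "inj_on (\<lambda>x. Tup (?X (X x)) (?Y (Y x))) (set_pmf p)"
  proof (rule inj_onI)
    fix x y assume xy: "x \<in> set_pmf p" "y \<in> set_pmf p"
      and eq: "Tup (?X (X x)) (?Y (Y x)) = Tup (?X (X y)) (?Y (Y y))"
    have "X x = X y"
      by (rule inj_onD[OF inj_on_to_point[of "map_pmf X p"]]) (use eq xy in auto)
    moreover have "Y x = Y y"
      by (rule inj_onD[OF inj_on_to_point[of "map_pmf Y p"]]) (use eq xy in auto)
    ultimately show "x = y" using inj xy by (auto simp: inj_on_def)
  qed
  then have "ent H p = H (map_pmf (\<lambda>x. Tup (?X (X x)) (?Y (Y x))) p)"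
    by (rule ent_eq[OF fin])
  also have "\<dots> = H (map_pmf (\<lambda>z. Tup (?X (X (?i z))) (?Y (Y (?i z)))) (map_pmf ?e p))"
    by (subst map_pmf_inv_into[OF inj_on_to_point]) simp
  also have "\<dots> \<le> H (map_pmf (\<lambda>z. ?X (X (?i z))) (map_pmf ?e p))
      + H (map_pmf (\<lambda>z. ?Y (Y (?i z))) (map_pmf ?e p))"
    using fin by (intro subadditive) (simp add: FinProb_def)
  also have "\<dots> = ent H (map_pmf X p) + ent H (map_pmf Y p)"
    unfolding map_pmf_inv_into[OF inj_on_to_point, where g = "\<lambda>x. ?X (X x)"]
      map_pmf_inv_into[OF inj_on_to_point, where g = "\<lambda>x. ?Y (Y x)"]
    by (simp add: ent_def map_pmf_comp)
  finally show ?thesis .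
qed

lemma ent_pair:
  assumes "finite (set_pmf p)" "finite (set_pmf q)"
  shows "ent H (pair_pmf p q) = ent H p + ent H q"
proof -
  have "ent H (pair_pmf p q) = H (map_pmf (\<lambda>(x, y). Tup (to_point p x) (to_point q y)) (pair_pmf p q))"
    using assms inj_on_to_point[of p] inj_on_to_point[of q]
    by (intro ent_eq) (auto simp: inj_on_def)
  also have "map_pmf (\<lambda>(x, y). Tup (to_point p x) (to_point q y)) (pair_pmf p q)
      = map_pmf (to_point p) p \<otimes>\<^sub>o map_pmf (to_point q) q"
    by (simp add: tensor_obj_def flip: map_pair) (simp add: map_pmf_comp case_prod_beta')
  also have "H \<dots> = ent H p + ent H q"
    unfolding ent_def using assms by (intro tensor) (simp_all add: FinProb_def)
  finally show ?thesis .
qed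

end

section \<open>Mixtures\<close>

definition mixture :: "real \<Rightarrow> 'b pmf \<Rightarrow> 'b pmf \<Rightarrow> 'b pmf" where
  "mixture t p q = bind_pmf (bernoulli_pmf t) (\<lambda>b. if b then p else q)"

text \<open>The sum type records which component was drawn, whereas \<open>mixture\<close> lets
  overlapping components merge.\<close>

definition disjoint_mixture :: "real \<Rightarrow> 'b pmf \<Rightarrow> 'c pmf \<Rightarrow> ('b + 'c) pmf" where
  "disjoint_mixture t p q = mixture t (map_pmf Inl p) (map_pmf Inr q)"

lemma pmf_mixture:
  assumes "0 \<le> t" "t \<le> 1"
  shows "pmf (mixture t p q) x = t * pmf p x + (1 - t) * pmf q x"
  using assms by (simp add: mixture_def pmf_bind algebra_simps)

lemma set_mixture_subset: "set_pmf (mixture t p q) \<subseteq> set_pmf p \<union> set_pmf q"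
  by (auto simp: mixture_def split: if_splits)

lemma finite_mixture [simp]: "finite (set_pmf p) \<Longrightarrow> finite (set_pmf q) \<Longrightarrow> finite (set_pmf (mixture t p q))"
  by (rule finite_subset[OF set_mixture_subset]) simp

lemma finite_disjoint_mixture [simp]:
  "finite (set_pmf p) \<Longrightarrow> finite (set_pmf q) \<Longrightarrow> finite (set_pmf (disjoint_mixture t p q))"
  by (simp add: disjoint_mixture_def)

lemma map_mixture: "map_pmf f (mixture t p q) = mixture t (map_pmf f p) (map_pmf f q)"
  by (auto simp: mixture_def map_bind_pmf intro!: bind_pmf_cong)

lemma pair_mixture: "pair_pmf (mixture t p q) r = mixture t (pair_pmf p r) (pair_pmf q r)"
  unfolding mixture_def pair_pmf_def bind_assoc_pmf by (intro bind_pmf_cong) auto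

context point_entropy
begin

text \<open>Exchanging the \<open>R\<close>-component of the mixture with an independent sample of \<open>R'\<close> is a bijection.\<close>

lemma ent_swap:
  assumes "finite (set_pmf R)" "finite (set_pmf R')" "finite (set_pmf S)"
  shows "ent H (disjoint_mixture t R S) + ent H R'
    \<le> ent H (disjoint_mixture t R' S) + ent H (mixture t R R')"
proof -
  let ?p = "pair_pmf (disjoint_mixture t R S) R'"
  let ?X = "\<lambda>(z, r'). case z of Inl r \<Rightarrow> Inl r' | Inr s \<Rightarrow> Inr s"
  let ?Y = "\<lambda>(z, r'). case z of Inl r \<Rightarrow> r | Inr s \<Rightarrow> r'"
  have X: "map_pmf ?X ?p = disjoint_mixture t R' S"
  proof -
    have "map_pmf ?X (pair_pmf (map_pmf Inl R) R') = map_pmf (\<lambda>z. Inl (snd z)) (pair_pmf R R')"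
      by (simp add: pair_map_pmf1 map_pmf_comp case_prod_beta')
    also have "\<dots> = map_pmf Inl R'"
      by (metis map_pmf_comp map_snd_pair_pmf)
    finally have 1: "map_pmf ?X (pair_pmf (map_pmf Inl R) R') = map_pmf Inl R'" .
    have "map_pmf ?X (pair_pmf (map_pmf Inr S) R') = map_pmf (\<lambda>z. Inr (fst z)) (pair_pmf S R')"
      by (simp add: pair_map_pmf1 map_pmf_comp case_prod_beta')
    also have "\<dots> = map_pmf Inr S"
      by (metis map_pmf_comp map_fst_pair_pmf)
    finally show ?thesis unfolding disjoint_mixture_def pair_mixture map_mixture 1 by (rule arg_cong)
  qed
  have Y: "map_pmf ?Y ?p = mixture t R R'"
  proof -
    have 1: "map_pmf ?Y (pair_pmf (map_pmf Inl R) R') = map_pmf fst (pair_pmf R R')"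
      by (simp add: pair_map_pmf1 map_pmf_comp case_prod_beta')
    have 2: "map_pmf ?Y (pair_pmf (map_pmf Inr S) R') = map_pmf snd (pair_pmf S R')"
      by (simp add: pair_map_pmf1 map_pmf_comp case_prod_beta')
    show ?thesis
      unfolding disjoint_mixture_def pair_mixture map_mixture 1 2 map_fst_pair_pmf map_snd_pair_pmf ..
  qed
  \<comment> \<open>The tag survives in \<open>?X\<close> and tells which of the two coordinates
    holds the sample of \<open>R'\<close>.\<close>
  have "inj_on (\<lambda>z. (?X z, ?Y z)) (set_pmf ?p)"
    by (auto simp: inj_on_def split: sum.splits)
  from ent_le_add[OF _ this] show ?thesis
    unfolding X Y using assms by (simp add: ent_pair)
qed

end

context
  fixes H :: "'a point pmf \<Rightarrow> 'w::ordered_ab_group_add"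
  assumes H: "point_entropy H"
begin

interpretation point_entropy H by (rule H)

text \<open>\<open>ent_swap\<close> is used for \<open>R\<close>, \<open>R'\<close> and for the
  exchanged pair; the disjoint mixtures occur on both sides and cancel, so a one-point
  \<open>S\<close> will do.\<close>

lemma ent_wright_concave:
  assumes "finite (set_pmf R)" "finite (set_pmf R')"
  shows "ent H R + ent H R' \<le> ent H (mixture t R R') + ent H (mixture t R' R)"
proof -
  define S where "S = return_pmf ()"
  have S: "finite (set_pmf S)" by (simp add: S_def)
  have "(ent H (disjoint_mixture t R S) + ent H R') + (ent H (disjoint_mixture t R' S) + ent H R)
      \<le> (ent H (disjoint_mixture t R' S) + ent H (mixture t R R'))
        + (ent H (disjoint_mixture t R S) + ent H (mixture t R' R))"
    by (intro add_mono ent_swap assms S)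
  then show ?thesis by (simp add: algebra_simps)
qed

end

section \<open>Natural multiples\<close>

definition nmult :: "nat \<Rightarrow> 'w \<Rightarrow> 'w::comm_monoid_add" where
  "nmult n x = (\<Sum>i<n. x)"

lemma nmult_0 [simp]: "nmult 0 x = 0"
  by (simp add: nmult_def)

lemma nmult_Suc: "nmult (Suc n) x = nmult n x + x"
  by (simp add: nmult_def)

lemma nmult_1 [simp]: "nmult (Suc 0) x = x"
  by (simp add: nmult_def)

lemma nmult_zero [simp]: "nmult n 0 = 0"
  by (simp add: nmult_def)

lemma nmult_add: "nmult n (x + y) = nmult n x + nmult n y"
  by (simp add: nmult_def sum.distrib)

lemma nmult_diff: "nmult n (x - y) = nmult n x - nmult n (y :: 'w::ab_group_add)"
  by (simp add: nmult_def sum_subtractf)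

lemma nmult_add_left: "nmult (m + n) x = nmult m x + nmult n x"
  by (induction n) (simp_all add: nmult_Suc add.assoc)

lemma nmult_mult: "nmult (m * n) x = nmult m (nmult n x)"
  by (induction m) (simp_all add: nmult_Suc nmult_add_left add.commute)

lemma nmult_mono: "x \<le> y \<Longrightarrow> nmult n x \<le> nmult n (y :: 'w::ordered_comm_monoid_add)"
  by (simp add: nmult_def sum_mono)

lemma nmult_nonneg: "0 \<le> x \<Longrightarrow> 0 \<le> nmult n (x :: 'w::ordered_comm_monoid_add)"
  using nmult_mono[of 0 x n] by simp

lemma nmult_le_mono: "m \<le> n \<Longrightarrow> 0 \<le> x \<Longrightarrow> nmult m x \<le> nmult n (x :: 'w::ordered_comm_monoid_add)"
  using nmult_add_left[of m "n - m" x] nmult_nonneg[of x "n - m"]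
    add_left_mono[of 0 "nmult (n - m) x" "nmult m x"] by simp

lemma nmult_bounded_imp_nonpos:
  fixes x y :: "'w::ic_ordered_ab_group_add"
  assumes "\<And>n. n \<ge> 1 \<Longrightarrow> nmult n x \<le> y"
  shows "x \<le> 0"
  using integrally_closed assms unfolding nmult_def by blast

text \<open>Dividing \<open>N\<close> by \<open>n\<close> with remainder, only the remainder
  contributes positively, and it is bounded by \<open>nmult n u\<close> independently of
  \<open>N\<close>; integral closedness then applies.\<close>

lemma unperforated:
  fixes x u :: "'w::ic_ordered_ab_group_add"
  assumes "nmult n x \<le> 0" "n \<ge> 1" "x \<le> u" "0 \<le> u"
  shows "x \<le> 0"
proof (rule nmult_bounded_imp_nonpos)
  fix N :: nat
  have "nmult N x = nmult (N div n) (nmult n x) + nmult (N mod n) x"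
    by (simp flip: nmult_mult nmult_add_left)
  also have "\<dots> \<le> 0 + nmult n u"
  proof (rule add_mono)
    show "nmult (N div n) (nmult n x) \<le> 0"
      using nmult_mono[OF assms(1), of "N div n"] by simp
    have "nmult (N mod n) x \<le> nmult (N mod n) u" by (rule nmult_mono[OF assms(3)])
    also have "\<dots> \<le> nmult n u"
      using assms(2,4) by (intro nmult_le_mono) (simp_all add: less_imp_le)
    finally show "nmult (N mod n) x \<le> nmult n u" .
  qed
  finally show "nmult N x \<le> nmult n u" by simp
qed

section \<open>Uniform distributions\<close>

abbreviation unif :: "nat \<Rightarrow> nat pmf" where
  "unif n \<equiv> pmf_of_set {..<n}"

lemma set_unif [simp]: "n > 0 \<Longrightarrow> set_pmf (unif n) = {..<n}"
  by (intro set_pmf_of_set) auto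

lemma pair_pmf_of_set:
  assumes "finite A" "A \<noteq> {}" "finite B" "B \<noteq> {}"
  shows "pair_pmf (pmf_of_set A) (pmf_of_set B) = pmf_of_set (A \<times> B)"
proof (rule pmf_eqI)
  fix z show "pmf (pair_pmf (pmf_of_set A) (pmf_of_set B)) z = pmf (pmf_of_set (A \<times> B)) z"
    using assms by (cases z) (simp add: pmf_pair card_cartesian_product indicator_def)
qed

lemma card_set_pmf_pos: "finite (set_pmf p) \<Longrightarrow> 0 < card (set_pmf p)"
  by (simp add: card_gt_0_iff set_pmf_not_empty)

context
  fixes H :: "'a point pmf \<Rightarrow> 'w::ordered_ab_group_add"
  assumes H: "point_entropy H"
begin

interpretation point_entropy H by (rule H)

lemma ent_pmf_of_set:
  assumes "finite A" "A \<noteq> {}"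
  shows "ent H (pmf_of_set A) = ent H (unif (card A))"
proof -
  have card: "card A > 0" using assms by (simp add: card_gt_0_iff)
  obtain f where f: "bij_betw f {..<card A} A"
    using ex_bij_betw_nat_finite[OF assms(1)] by (auto simp: atLeast0LessThan)
  have "map_pmf f (unif (card A)) = pmf_of_set A"
    using assms card by (intro map_pmf_of_set_bij_betw[OF f]) auto
  moreover have "inj_on f (set_pmf (unif (card A)))" "finite (set_pmf (unif (card A)))"
    using card bij_betw_imp_inj_on[OF f] by simp_all
  ultimately show ?thesis using ent_map_inj by metis
qed

text \<open>Adding an independent uniform shift modulo \<open>n\<close> turns any distribution into the uniform one,
  and the original value is determined by the sum and the shift.\<close>

lemma ent_le_unif:
  assumes fin: "finite (set_pmf R)" and card: "card (set_pmf R) \<le> n"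
  shows "ent H R \<le> ent H (unif n)"
proof -
  obtain f where f: "bij_betw f (set_pmf R) {..<card (set_pmf R)}"
    using ex_bij_betw_finite_nat[OF fin] by (auto simp: atLeast0LessThan)
  define R' where "R' = map_pmf f R"
  have R': "ent H R' = ent H R" "finite (set_pmf R')" "set_pmf R' \<subseteq> {..<n}"
    using f fin card unfolding R'_def
    by (auto intro!: ent_map_inj simp: bij_betw_def)
  have n: "n > 0" using card_set_pmf_pos[OF fin] card by simp
  let ?X = "\<lambda>(x, z). (x + z) mod n"
  have shift: "map_pmf (\<lambda>z. (x + z) mod n) (unif n) = unif n" if "x < n" for x
  proof (rule map_pmf_of_set_bij_betw)
    have "inj_on (\<lambda>z. (x + z) mod n) {..<n}"
    proof (rule inj_onI)
      fix a b assume ab: "a \<in> {..<n}" "b \<in> {..<n}" and eq: "(x + a) mod n = (x + b) mod n"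
      from eq have "a mod n = b mod n" by (auto simp: nat_mod_eq_iff)
      then show "a = b" using ab by simp
    qed
    moreover have "(\<lambda>z. (x + z) mod n) ` {..<n} \<subseteq> {..<n}" using n by auto
    ultimately show "bij_betw (\<lambda>z. (x + z) mod n) {..<n} {..<n}"
      by (simp add: bij_betw_def endo_inj_surj)
  qed (use n in auto)
  have "map_pmf ?X (pair_pmf R' (unif n)) = bind_pmf R' (\<lambda>x. map_pmf (\<lambda>z. (x + z) mod n) (unif n))"
    by (simp add: pair_pmf_def map_bind_pmf map_pmf_def bind_assoc_pmf bind_return_pmf)
  also have "\<dots> = bind_pmf R' (\<lambda>x. unif n)"
    using R'(3) by (intro bind_pmf_cong) (auto simp: shift)
  finally have X: "map_pmf ?X (pair_pmf R' (unif n)) = unif n" by (simp add: bind_pmf_const)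
  have "inj_on (\<lambda>z. (?X z, snd z)) (set_pmf (pair_pmf R' (unif n)))"
  proof (rule inj_onI)
    fix u v assume "u \<in> set_pmf (pair_pmf R' (unif n))" "v \<in> set_pmf (pair_pmf R' (unif n))"
    and eq: "(?X u, snd u) = (?X v, snd v)"
    then have "fst u < n" "fst v < n" using R'(3) by auto
    moreover have "(fst u + snd u) mod n = (fst v + snd u) mod n" using eq by (auto simp: case_prod_beta)
    then have "fst u mod n = fst v mod n"
      using nat_mod_eq_iff by auto
    ultimately show "u = v" using eq by (simp add: prod_eq_iff)
  qed
  from ent_le_add[OF _ this] have "ent H R' + ent H (unif n) \<le> ent H (unif n) + ent H (unif n)"
    unfolding X map_snd_pair_pmf using R'(2) n by (simp add: ent_pair)
  then show ?thesis using R'(1) by simp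
qed

lemma ent_unif_mult:
  assumes "m > 0" "n > 0"
  shows "ent H (unif (m * n)) = ent H (unif m) + ent H (unif n)"
proof -
  have "ent H (pair_pmf (unif m) (unif n)) = ent H (unif m) + ent H (unif n)"
    using assms by (intro ent_pair) auto
  also have "pair_pmf (unif m) (unif n) = pmf_of_set ({..<m} \<times> {..<n})"
    using assms by (intro pair_pmf_of_set) auto
  also have "ent H \<dots> = ent H (unif (m * n))"
    using assms by (subst ent_pmf_of_set) (auto simp: card_cartesian_product)
  finally show ?thesis by simp
qed

lemma ent_unif_1: "ent H (unif 1) = 0"
  using ent_return[of "0::nat"] by (simp add: pmf_of_set_singleton lessThan_Suc)

lemma ent_unif_power: "m > 0 \<Longrightarrow> ent H (unif (m ^ n)) = nmult n (ent H (unif m))"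
  using ent_unif_1 by (induction n) (simp_all add: ent_unif_mult nmult_Suc add.commute)

lemma ent_le_pmf_of_set:
  assumes "set_pmf R \<subseteq> A" "finite A"
  shows "ent H R \<le> ent H (pmf_of_set A)"
proof -
  have "A \<noteq> {}" using assms set_pmf_not_empty by fastforce
  then show ?thesis
    using assms by (auto simp: ent_pmf_of_set card_mono intro!: ent_le_unif finite_subset[OF assms])
qed

text \<open>In the inequality \<open>ent_wright_concave\<close> for the uniform distribution and
  \<open>R\<close>, the exchanged mixture is at most the uniform value, which cancels.\<close>

lemma ent_le_mixture_uniform:
  assumes "set_pmf R \<subseteq> A" "finite A"
  shows "ent H R \<le> ent H (mixture t (pmf_of_set A) R)"
proof -
  have A: "A \<noteq> {}" "finite (set_pmf R)" using assms set_pmf_not_empty finite_subset by fastforce+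
  then have U: "set_pmf (pmf_of_set A) = A" using assms by simp
  have "ent H (pmf_of_set A) + ent H R
      \<le> ent H (mixture t (pmf_of_set A) R) + ent H (mixture t R (pmf_of_set A))"
    by (rule ent_wright_concave[OF H]) (use A U assms in auto)
  also have "\<dots> \<le> ent H (mixture t (pmf_of_set A) R) + ent H (pmf_of_set A)"
    using set_mixture_subset[of t R "pmf_of_set A"] U assms
    by (intro add_left_mono ent_le_pmf_of_set) auto
  finally show ?thesis by simp
qed

lemma ent_mixture_uniform_mono:
  assumes "set_pmf R \<subseteq> A" "finite A" "0 \<le> s" "s \<le> t" "t \<le> 1"
  shows "ent H (mixture s (pmf_of_set A) R) \<le> ent H (mixture t (pmf_of_set A) R)"
proof (cases "s = 1")
  case False
  \<comment> \<open>Going from weight \<open>s\<close> to weight \<open>t\<close> is mixing in the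
    uniform distribution once more, with \<open>?r\<close> solving
    \<open>?r * (1 - s) = t - s\<close>; hence the exception \<open>s = 1\<close>.\<close>
  let ?U = "pmf_of_set A" and ?r = "(t - s) / (1 - s)"
  have A: "A \<noteq> {}" using assms set_pmf_not_empty by fastforce
  have r: "0 \<le> ?r" "?r \<le> 1" using assms False by auto
  have "mixture t ?U R = mixture ?r ?U (mixture s ?U R)"
  proof (rule pmf_eqI)
    fix x
    have "?r * (1 - s) = t - s" using False by simp
    then have "?r * u + (1 - ?r) * (s * u + (1 - s) * v) = t * u + (1 - t) * v" for u v
      by algebra
    then show "pmf (mixture t ?U R) x = pmf (mixture ?r ?U (mixture s ?U R)) x"
      using assms r by (simp only: pmf_mixture)
  qed
  moreover have "set_pmf (mixture s ?U R) \<subseteq> A"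
    using set_mixture_subset[of s ?U R] assms A by auto
  ultimately show ?thesis using ent_le_mixture_uniform assms(2) by metis
qed (use assms in auto)

end

section \<open>Flattening a part of a distribution\<close>

lemma exists_pmf_of_weights:
  assumes "finite A" "\<And>x. 0 \<le> f x" "\<And>x. x \<notin> A \<Longrightarrow> f x = 0" "sum f A = 1"
  shows "\<exists>p. \<forall>x. pmf p x = f x"
proof -
  have "(\<integral>\<^sup>+ x. ennreal (f x) \<partial>count_space UNIV) = (\<Sum>x\<in>A. ennreal (f x))"
    using assms by (intro nn_integral_count_space') auto
  also have "\<dots> = 1" using assms by (simp add: sum_ennreal)
  finally have "pmf (embed_pmf f) x = f x" for x
    using assms(2) by (intro pmf_embed_pmf) auto
  then show ?thesis by blast
qed

text \<open>If \<open>1 / n\<close> is at most the smallest atom, a uniform share of total weight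
  \<open>1 / n\<close> can be subtracted from \<open>R\<close>. The weight is the reciprocal of an
  integer so that \<open>R\<close> falls on the grid of \<open>ent_flatten_le\<close>.\<close>

lemma exists_mixture_uniform:
  assumes "finite (set_pmf R)"
  shows "\<exists>n>1. \<exists>R'. set_pmf R' \<subseteq> set_pmf R \<and> R = mixture (1 / real n) (pmf_of_set (set_pmf R)) R'"
proof -
  let ?A = "set_pmf R"
  have A: "finite ?A" "?A \<noteq> {}" using assms set_pmf_not_empty by auto
  define \<epsilon> where "\<epsilon> = Min (pmf R ` ?A)"
  have "\<epsilon> \<in> pmf R ` ?A" unfolding \<epsilon>_def using A by (intro Min_in) auto
  then have "\<epsilon> > 0" by (auto simp: pmf_positive)
  then obtain k where k: "1 / real (Suc k) < \<epsilon>" by (rule nat_approx_posE)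
  \<comment> \<open>The second \<open>Suc\<close> forces \<open>n > 1\<close>, so that
    \<open>R'\<close> can be normalised by \<open>1 - 1 / n\<close>.\<close>
  define n where "n = Suc (Suc k)"
  have "1 / real n \<le> 1 / real (Suc k)" unfolding n_def by (intro divide_left_mono) auto
  with k have n: "n > 1" "1 / real n \<le> \<epsilon>" by (simp_all add: n_def)
  define f where "f x = (if x \<in> ?A then (pmf R x - 1 / (real n * real (card ?A))) / (1 - 1 / real n) else 0)" for x
  have c: "real (card ?A) \<ge> 1" using card_set_pmf_pos[OF assms] by linarith
  have n1: "1 - 1 / real n > 0" using n by simp
  have "0 \<le> f x" for x
  proof (cases "x \<in> ?A")
    case True
    have "1 / (real n * real (card ?A)) \<le> 1 / real n"
      using c n by (simp add: field_simps)
    also have "\<dots> \<le> \<epsilon>" by (rule n(2))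
    also have "\<epsilon> \<le> pmf R x" unfolding \<epsilon>_def using A True by (intro Min_le) auto
    finally show ?thesis using n1 by (simp add: f_def)
  qed (simp add: f_def)
  moreover have "sum f ?A = 1"
  proof -
    have "sum f ?A = (\<Sum>x\<in>?A. pmf R x - 1 / (real n * real (card ?A))) / (1 - 1 / real n)"
      by (simp add: f_def sum_divide_distrib)
    also have "(\<Sum>x\<in>?A. pmf R x - 1 / (real n * real (card ?A))) = 1 - 1 / real n"
      using sum_pmf_eq_1[OF assms order.refl] c by (simp add: sum_subtractf)
    finally show ?thesis using n(1) by simp
  qed
  ultimately obtain R' where R': "\<And>x. pmf R' x = f x"
    using exists_pmf_of_weights[of ?A f] A by (auto simp: f_def)
  have "set_pmf R' \<subseteq> ?A" using R' by (auto simp: set_pmf_iff f_def split: if_splits)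
  moreover have "R = mixture (1 / real n) (pmf_of_set ?A) R'"
  proof (rule pmf_eqI)
    fix x
    have "pmf (mixture (1 / real n) (pmf_of_set ?A) R') x
        = 1 / real n * (indicator ?A x / card ?A) + (1 - 1 / real n) * f x"
      using n A by (subst pmf_mixture) (simp_all add: R')
    also have "\<dots> = pmf R x"
      using n(1) by (cases "x \<in> ?A") (simp_all add: f_def set_pmf_iff)
    finally show "pmf R x = pmf (mixture (1 / real n) (pmf_of_set ?A) R') x" by simp
  qed
  ultimately show ?thesis using n by blast
qed

context
  fixes H :: "'a point pmf \<Rightarrow> 'w::ordered_ab_group_add"
  assumes H: "point_entropy H"
begin

interpretation point_entropy H by (rule H)

text \<open>Move from \<open>R\<close> to the uniform distribution \<open>U\<close> in \<open>n\<close> blocks of \<open>q\<close> steps. By \<open>ent_swap\<close>, the increment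
  of the left-hand side over a block is at most one step of the concave function \<open>t \<mapsto> ent H (r t)\<close>,
  hence at most the average of the \<open>q\<close> preceding steps. Starting at the slightly less uniform \<open>R'\<close>
  provides these preceding steps for the first block as well.\<close>

lemma ent_flatten_le:
  assumes R: "finite (set_pmf R)" and S: "finite (set_pmf S)"
    and t: "0 \<le> t" "t * real q \<le> 1" and q: "q \<ge> 1"
  defines "U \<equiv> pmf_of_set (set_pmf R)"
  shows "nmult q (ent H (disjoint_mixture t U S)) \<le> nmult q (ent H (disjoint_mixture t R S)) + ent H U"
proof -
  let ?A = "set_pmf R"
  obtain n R' where n: "n > 1" and R': "set_pmf R' \<subseteq> ?A" and R_eq: "R = mixture (1 / real n) U R'"
    using exists_mixture_uniform[OF R] unfolding U_def by blast
  have set_U: "set_pmf U = ?A" using R by (simp add: U_def set_pmf_not_empty)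
  \<comment> \<open>Here \<open>r (1 / n) = R\<close> and \<open>r 1 = U\<close>, so the claim
    compares \<open>G 1\<close> with \<open>G n\<close>. Blocks have length \<open>1 / n\<close>;
    \<open>a\<close> samples the same segment \<open>q\<close> times more finely.\<close>
  define r where "r s = mixture s U R'" for s :: real
  define a where "a j = ent H (r (real j / (real n * real q)))" for j :: nat
  define G where "G i = ent H (disjoint_mixture t (r (real i / real n)) S)" for i :: nat
  have nq: "real n * real q > 0" using n q by simp
  have fin: "finite (set_pmf (r s))" for s
    unfolding r_def using R R' set_U by (auto intro!: finite_mixture intro: finite_subset)
  have a_eq: "a (i * q) = ent H (r (real i / real n))" for i
    using q by (simp add: a_def)
  have pmf_r: "pmf (r s) x = s * pmf U x + (1 - s) * pmf R' x" if "0 \<le> s" "s \<le> 1" for s x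
    using that by (simp add: r_def pmf_mixture)
  have mix_r: "mixture u (r s) (r s') = r (u * s + (1 - u) * s')"
    if "0 \<le> u" "u \<le> 1" "0 \<le> s" "s \<le> 1" "0 \<le> s'" "s' \<le> 1" for u s s'
  proof (rule pmf_eqI)
    fix x
    have "0 \<le> u * s + (1 - u) * s'" using that by simp
    moreover have "u * s + (1 - u) * s' \<le> 1" using that by (intro convex_bound_le) auto
    ultimately show "pmf (mixture u (r s) (r s')) x = pmf (r (u * s + (1 - u) * s')) x"
      using that by (simp add: pmf_mixture pmf_r) (simp add: algebra_simps)
  qed
  have r_mono: "ent H (r s) \<le> ent H (r s')" if "0 \<le> s" "s \<le> s'" "s' \<le> 1" for s s'
    unfolding r_def U_def using R R' that by (intro ent_mixture_uniform_mono[OF H])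
  have in_unit: "0 \<le> real j / (real n * real q) \<and> real j / (real n * real q) \<le> 1" if "j \<le> n * q" for j
    using that nq by (simp add: divide_le_eq flip: of_nat_mult)
  have concave: "a (Suc (Suc j)) - a (Suc j) \<le> a (Suc j) - a j" if "Suc (Suc j) \<le> n * q" for j
  proof -
    let ?s = "\<lambda>j. real j / (real n * real q)"
    have s: "0 \<le> ?s j" "?s j \<le> 1" "0 \<le> ?s (Suc (Suc j))" "?s (Suc (Suc j)) \<le> 1"
      using in_unit[of j] in_unit[of "Suc (Suc j)"] that by simp_all
    have eq: "1/2 * ?s (Suc (Suc j)) + (1 - 1/2) * ?s j = ?s (Suc j)"
      "1/2 * ?s j + (1 - 1/2) * ?s (Suc (Suc j)) = ?s (Suc j)"
      using n q by (simp_all add: field_simps)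
    \<comment> \<open>At weight 1/2 both mixtures are the same midpoint, so
      \<open>ent_wright_concave\<close> becomes concavity on the grid.\<close>
    have "mixture (1/2) (r (?s (Suc (Suc j)))) (r (?s j)) = r (?s (Suc j))"
      "mixture (1/2) (r (?s j)) (r (?s (Suc (Suc j)))) = r (?s (Suc j))"
      using mix_r[of "1/2", OF _ _ s(3,4,1,2)] mix_r[of "1/2", OF _ _ s] unfolding eq by simp_all
    with ent_wright_concave[OF H fin fin, of "?s (Suc (Suc j))" "?s j" "1/2"]
    have "a (Suc (Suc j)) + a j \<le> a (Suc j) + a (Suc j)" by (simp add: a_def)
    then show ?thesis by (simp add: algebra_simps)
  qed
  have antimono: "a (Suc (j + k)) - a (j + k) \<le> a (Suc j) - a j" if "Suc (j + k) \<le> n * q" for j k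
    using that
  proof (induction k)
    case (Suc k)
    then show ?case using concave[of "j + k"] by (simp add: order_trans)
  qed simp
  have step: "G (Suc i) - G i \<le> a (Suc (i * q)) - a (i * q)" if "i < n" for i
  proof -
    let ?s = "real i / real n" and ?s' = "real (Suc i) / real n"
    have s: "0 \<le> ?s" "?s \<le> 1" "0 \<le> ?s'" "?s' \<le> 1" using that by auto
    have t1: "t \<le> 1" using t q mult_left_mono[of 1 "real q" t] by simp
    have "ent H (disjoint_mixture t (r ?s') S) + ent H (r ?s)
        \<le> ent H (disjoint_mixture t (r ?s) S) + ent H (mixture t (r ?s') (r ?s))"
      by (intro ent_swap fin S)
    also have "ent H (mixture t (r ?s') (r ?s)) \<le> a (Suc (i * q))"
    proof -
      \<comment> \<open>The mixture lies only \<open>t / n\<close> past the start of the block, and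
        \<open>t * q \<le> 1\<close> makes this at most one fine step.\<close>
      have "t * ?s' + (1 - t) * ?s = ?s + t / real n" using n by (simp add: field_simps)
      then have eq: "mixture t (r ?s') (r ?s) = r (?s + t / real n)"
        using mix_r[OF t(1) t1 s(3,4,1,2)] by simp
      have le: "?s + t / real n \<le> real (Suc (i * q)) / (real n * real q)"
        using t n q by (simp add: field_simps)
      have "Suc (i * q) \<le> n * q"
        using that q mult_le_mono1[of "Suc i" n q] by simp
      from in_unit[OF this] le show ?thesis
        unfolding a_def eq using s(1) t(1) n by (intro r_mono) auto
    qed
    finally show ?thesis unfolding G_def a_eq by (simp add: algebra_simps)
  qed
  have block: "nmult q (G (Suc (Suc i)) - G (Suc i)) \<le> a (Suc i * q + 1) - a (i * q + 1)"
    if "Suc i < n" for i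
  proof -
    \<comment> \<open>The window is shifted by one: its last step, starting at
      \<open>Suc i * q\<close>, is the one in \<open>step\<close>, and the \<open>q - 1\<close>
      steps before it are at least as large by \<open>antimono\<close>. Consecutive windows abut, so
      their bounds telescope.\<close>
    have "nmult q (G (Suc (Suc i)) - G (Suc i)) \<le> (\<Sum>l<q. a (Suc (i * q + 1 + l)) - a (i * q + 1 + l))"
      unfolding nmult_def
    proof (rule sum_mono)
      fix l assume l: "l \<in> {..<q}"
      then have eq: "i * q + 1 + l + (q - 1 - l) = Suc i * q" by simp
      have "Suc (Suc i * q) \<le> n * q"
        using that q mult_le_mono1[of "Suc (Suc i)" n q] by simp
      then show "G (Suc (Suc i)) - G (Suc i) \<le> a (Suc (i * q + 1 + l)) - a (i * q + 1 + l)"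
        using step[OF that] antimono[of "i * q + 1 + l" "q - 1 - l"] unfolding eq
        by (meson order_trans)
    qed
    also have "\<dots> = a (Suc i * q + 1) - a (i * q + 1)"
      using sum_lessThan_telescope[of "\<lambda>l. a (i * q + 1 + l)" q] by (simp add: ac_simps)
    finally show ?thesis .
  qed
  have "nmult q (G (Suc i) - G 1) \<le> a (i * q + 1) - a 1" if "i < n" for i
    using that
  proof (induction i)
    case (Suc i)
    have "nmult q (G (Suc (Suc i)) - G 1) = nmult q (G (Suc (Suc i)) - G (Suc i)) + nmult q (G (Suc i) - G 1)"
      by (simp flip: nmult_add)
    also have "\<dots> \<le> (a (Suc i * q + 1) - a (i * q + 1)) + (a (i * q + 1) - a 1)"
      using Suc by (intro add_mono block) auto
    finally show ?case by simp
  qed simp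
  from this[of "n - 1"] have "nmult q (G n - G 1) \<le> a ((n - 1) * q + 1) - a 1"
    using n by simp
  also have "\<dots> \<le> ent H U - 0"
  proof (rule diff_mono)
    show "0 \<le> a 1" unfolding a_def by (intro ent_nonneg fin)
    have "set_pmf (r s) \<subseteq> ?A" for s
      unfolding r_def using set_mixture_subset[of s U R'] set_U R' by auto
    then show "a ((n - 1) * q + 1) \<le> ent H U"
      unfolding a_def U_def using R by (intro ent_le_pmf_of_set[OF H])
  qed
  finally have "nmult q (G n - G 1) \<le> ent H U" by simp
  moreover have "G 1 = ent H (disjoint_mixture t R S)" by (simp add: G_def r_def flip: R_eq)
  moreover have "G n = ent H (disjoint_mixture t U S)"
  proof -
    have "r 1 = U" by (rule pmf_eqI) (simp add: pmf_r)
    then show ?thesis using n by (simp add: G_def)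
  qed
  ultimately show ?thesis by (simp add: nmult_diff algebra_simps)
qed

end

section \<open>Couplings and splittings\<close>

text \<open>The two families of atoms are laid out as consecutive subintervals of the unit interval; the weight
  of a pair is the length of the overlap.\<close>

lemma exists_interval_coupling:
  fixes X Y :: "nat pmf"
  assumes X: "set_pmf X = {..<n}" and Y: "set_pmf Y = {..<m}"
    and X_le: "\<And>i. pmf X i \<le> \<theta>" and Y_ge: "\<And>j. j < m \<Longrightarrow> \<theta> \<le> pmf Y j"
  shows "\<exists>J. finite (set_pmf J) \<and> map_pmf fst J = X \<and> map_pmf snd J = Y \<and>
    (\<forall>i j j'. (i, j) \<in> set_pmf J \<longrightarrow> (i, j') \<in> set_pmf J \<longrightarrow> j' \<le> Suc j)"
proof -
  define a where "a i = (\<Sum>k<i. pmf X k)" for i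
  define b where "b j = (\<Sum>k<j. pmf Y k)" for j
  define w where "w z = (case z of (i, j) \<Rightarrow> if i < n \<and> j < m
      then max 0 (min (a (Suc i)) (b (Suc j)) - max (a i) (b j)) else 0)" for z
  have a_Suc: "a (Suc i) = a i + pmf X i" for i by (simp add: a_def)
  have b_Suc: "b (Suc j) = b j + pmf Y j" for j by (simp add: b_def)
  have a0: "a 0 = 0" and b0: "b 0 = 0" by (simp_all add: a_def b_def)
  have an: "a n = 1" using X by (simp add: a_def sum_pmf_eq_1)
  have bm: "b m = 1" using Y by (simp add: b_def sum_pmf_eq_1)
  have a_mono: "a i \<le> a i'" if "i \<le> i'" for i i'
    unfolding a_def using that by (intro sum_mono2) auto
  have b_mono: "b j \<le> b j'" if "j \<le> j'" for j j'
    unfolding b_def using that by (intro sum_mono2) auto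
  have a01: "0 \<le> a i" "i \<le> n \<Longrightarrow> a i \<le> 1" for i
    using a_mono[of 0 i] a_mono[of i n] a0 an by auto
  have b01: "0 \<le> b j" "j \<le> m \<Longrightarrow> b j \<le> 1" for j
    using b_mono[of 0 j] b_mono[of j m] b0 bm by auto
  have row: "(\<Sum>j<m. w (i, j)) = pmf X i" if "i < n" for i
  proof -
    \<comment> \<open>\<open>?c\<close> clamps to the interval of atom \<open>i\<close>; an overlap
      is a difference of clamped endpoints, and these telescope along the row.\<close>
    let ?c = "\<lambda>t. min (a (Suc i)) (max (a i) t)"
    have "(\<Sum>j<m. w (i, j)) = (\<Sum>j<m. ?c (b (Suc j)) - ?c (b j))"
    proof (rule sum.cong)
      fix j assume "j \<in> {..<m}"
      then show "w (i, j) = ?c (b (Suc j)) - ?c (b j)"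
        using a_mono[of i "Suc i"] b_mono[of j "Suc j"] that by (simp add: w_def)
    qed simp
    also have "\<dots> = ?c (b m) - ?c (b 0)" by (rule sum_lessThan_telescope)
    also have "\<dots> = pmf X i"
      using a01[of i] a01[of "Suc i"] that by (simp add: b0 bm a_Suc min_def max_def)
    finally show ?thesis .
  qed
  have col: "(\<Sum>i<n. w (i, j)) = pmf Y j" if "j < m" for j
  proof -
    let ?c = "\<lambda>t. min (b (Suc j)) (max (b j) t)"
    have "(\<Sum>i<n. w (i, j)) = (\<Sum>i<n. ?c (a (Suc i)) - ?c (a i))"
    proof (rule sum.cong)
      fix i assume "i \<in> {..<n}"
      then show "w (i, j) = ?c (a (Suc i)) - ?c (a i)"
        using b_mono[of j "Suc j"] a_mono[of i "Suc i"] that by (simp add: w_def)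
    qed simp
    also have "\<dots> = ?c (a n) - ?c (a 0)" by (rule sum_lessThan_telescope)
    also have "\<dots> = pmf Y j"
      using b01[of j] b01[of "Suc j"] that by (simp add: a0 an b_Suc min_def max_def)
    finally show ?thesis .
  qed
  have "sum w ({..<n} \<times> {..<m}) = (\<Sum>i<n. \<Sum>j<m. w (i, j))"
    by (simp add: sum.cartesian_product)
  also have "\<dots> = 1" using row an by (simp add: a_def)
  finally have sum: "sum w ({..<n} \<times> {..<m}) = 1" .
  obtain J where J: "\<And>z. pmf J z = w z"
    using exists_pmf_of_weights[OF _ _ _ sum] by (force simp: w_def split: prod.splits)
  have sub: "set_pmf J \<subseteq> {..<n} \<times> {..<m}"
    using J by (auto simp: set_pmf_iff w_def split: if_splits)
  have fst: "map_pmf fst J = X"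
  proof (rule pmf_eqI)
    fix i
    show "pmf (map_pmf fst J) i = pmf X i"
    proof (cases "i < n")
      case True
      then have "{z \<in> {..<n} \<times> {..<m}. fst z = i} = {i} \<times> {..<m}" by auto
      then have "pmf (map_pmf fst J) i = (\<Sum>z\<in>{i} \<times> {..<m}. w z)"
        using pmf_map_finite[OF _ sub, of fst i] by (simp add: J)
      also have "\<dots> = (\<Sum>j<m. w (i, j))"
        by (rule sum.reindex_bij_witness[of _ "Pair i" snd]) auto
      finally show ?thesis using row[OF True] by simp
    next
      case False
      then have "i \<notin> set_pmf X" "i \<notin> set_pmf (map_pmf fst J)" using X sub by auto
      then show ?thesis by (metis set_pmf_iff)
    qed
  qed
  have snd: "map_pmf snd J = Y"
  proof (rule pmf_eqI)
    fix j
    show "pmf (map_pmf snd J) j = pmf Y j"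
    proof (cases "j < m")
      case True
      then have "{z \<in> {..<n} \<times> {..<m}. snd z = j} = {..<n} \<times> {j}" by auto
      then have "pmf (map_pmf snd J) j = (\<Sum>z\<in>{..<n} \<times> {j}. w z)"
        using pmf_map_finite[OF _ sub, of snd j] by (simp add: J)
      also have "\<dots> = (\<Sum>i<n. w (i, j))"
        by (rule sum.reindex_bij_witness[of _ "\<lambda>i. (i, j)" fst]) auto
      finally show ?thesis using col[OF True] by simp
    next
      case False
      then have "j \<notin> set_pmf Y" "j \<notin> set_pmf (map_pmf snd J)" using Y sub by auto
      then show ?thesis by (metis set_pmf_iff)
    qed
  qed
  have "j' \<le> Suc j" if "(i, j) \<in> set_pmf J" "(i, j') \<in> set_pmf J" for i j j'
  proof (rule ccontr)
    assume "\<not> j' \<le> Suc j"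
    \<comment> \<open>Atom \<open>Suc j\<close> of \<open>Y\<close> would be an interval of length
      at least \<open>\<theta>\<close> strictly inside one of length at most
      \<open>\<theta>\<close>.\<close>
    then have j': "Suc (Suc j) \<le> j'" by simp
    have w: "w (i, j) > 0" "w (i, j') > 0" using that by (simp_all add: pmf_positive flip: J)
    then have "a i < b (Suc j)" "b j' < a (Suc i)" "j' < m" by (auto simp: w_def split: if_splits)
    moreover have "b (Suc (Suc j)) \<le> b j'" using j' by (rule b_mono)
    moreover have "\<theta> \<le> pmf Y (Suc j)" using j' \<open>j' < m\<close> by (intro Y_ge) simp
    ultimately show False using X_le[of i] b_Suc[of "Suc j"] a_Suc[of i] by linarith
  qed
  then show ?thesis using fst snd finite_subset[OF sub] by auto
qed

text \<open>Descending from \<open>A\<close>, discarding an element of largest weight never raises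
  the average.\<close>

lemma exists_light_subset:
  fixes f :: "'b \<Rightarrow> real"
  assumes "finite A" "k \<le> card A"
  shows "\<exists>K\<subseteq>A. card K = k \<and> real (card A) * sum f K \<le> real k * sum f A"
  using assms(2)
proof (induction rule: inc_induct)
  case base
  then show ?case by auto
next
  case (step k)
  then obtain K where K: "K \<subseteq> A" "card K = Suc k" "real (card A) * sum f K \<le> real (Suc k) * sum f A"
    by blast
  have finK: "finite K" "K \<noteq> {}" using K finite_subset[OF K(1) assms(1)] by auto
  then have "Max (f ` K) \<in> f ` K" by (intro Max_in) auto
  then obtain x where x: "x \<in> K" "f x = Max (f ` K)" by auto
  have "sum f K \<le> (\<Sum>y\<in>K. f x)" using finK x by (intro sum_mono) simp
  then have "sum f K \<le> real (Suc k) * f x" using K(2) by simp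
  moreover have eq: "sum f (K - {x}) = sum f K - f x" using finK x by (simp add: sum_diff1)
  ultimately have "real (Suc k) * sum f (K - {x}) \<le> real k * sum f K"
    unfolding eq by (simp add: algebra_simps)
  then have "real (card A) * (real (Suc k) * sum f (K - {x})) \<le> real (card A) * (real k * sum f K)"
    by (intro mult_left_mono) auto
  also have "\<dots> = real k * (real (card A) * sum f K)" by simp
  also have "\<dots> \<le> real k * (real (Suc k) * sum f A)" using K(3) by (intro mult_left_mono) auto
  finally have "real (Suc k) * (real (card A) * sum f (K - {x})) \<le> real (Suc k) * (real k * sum f A)"
    by (simp add: mult_ac)
  then have "real (card A) * sum f (K - {x}) \<le> real k * sum f A"
    by (rule mult_left_le_imp_le) simp
  moreover have "K - {x} \<subseteq> A" "card (K - {x}) = k" using K x finK by auto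
  ultimately show ?case by blast
qed

section \<open>Splitting a distribution along an event\<close>

lemma pmf_disjoint_mixture:
  assumes "0 \<le> t" "t \<le> 1"
  shows "pmf (disjoint_mixture t p q) (Inl x) = t * pmf p x"
    and "pmf (disjoint_mixture t p q) (Inr y) = (1 - t) * pmf q y"
proof -
  have "pmf (map_pmf Inr q) (Inl x) = 0" "pmf (map_pmf Inl p) (Inr y) = 0"
    by (auto intro!: pmf_map_outside)
  then show "pmf (disjoint_mixture t p q) (Inl x) = t * pmf p x"
    "pmf (disjoint_mixture t p q) (Inr y) = (1 - t) * pmf q y"
    using assms by (simp_all add: disjoint_mixture_def pmf_mixture pmf_map_inj')
qed

lemma set_disjoint_mixture:
  assumes "0 < t" "t < 1"
  shows "set_pmf (disjoint_mixture t p q) = Inl ` set_pmf p \<union> Inr ` set_pmf q"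
  using assms by (auto simp: disjoint_mixture_def mixture_def split: if_splits)

text \<open>The law of total probability with the event kept as a tag. Tagging is injective, so
  \<open>ent_flatten_le\<close> can act on the conditional distribution of \<open>E\<close>
  alone.\<close>

lemma map_pmf_split_event:
  fixes p :: "'b pmf"
  assumes "0 < measure p E" "measure p E < 1"
  shows "map_pmf (\<lambda>x. if x \<in> E then Inl x else Inr x) p
    = disjoint_mixture (measure p E) (cond_pmf p E) (cond_pmf p (- E))"
proof (rule pmf_eqI)
  let ?h = "\<lambda>x. if x \<in> E then Inl x else Inr x"
  have E: "set_pmf p \<inter> E \<noteq> {}" "set_pmf p \<inter> - E \<noteq> {}"
  proof -
    show "set_pmf p \<inter> E \<noteq> {}"
      using assms(1) measure_Int_set_pmf[of p E] by (auto simp: Int_commute)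
    show "set_pmf p \<inter> - E \<noteq> {}"
      using assms(2) measure_pmf.prob_eq_1[of E p] by (auto simp: AE_measure_pmf_iff)
  qed
  have c: "measure p (- E) = 1 - measure p E"
    using measure_pmf.prob_compl[of E p] by (simp add: Compl_eq_Diff_UNIV)
  fix z :: "'b + 'b"
  show "pmf (map_pmf ?h p) z = pmf (disjoint_mixture (measure p E) (cond_pmf p E) (cond_pmf p (- E))) z"
  proof (cases z)
    case (Inl x)
    have "?h -` {Inl x} = (if x \<in> E then {x} else {})" by (auto split: if_splits)
    then show ?thesis
      using assms E by (simp add: Inl pmf_disjoint_mixture pmf_map pmf_cond measure_pmf_single)
  next
    case (Inr x)
    have "?h -` {Inr x} = (if x \<in> E then {} else {x})" by (auto split: if_splits)
    then show ?thesis
      using assms E by (simp add: Inr pmf_disjoint_mixture pmf_map pmf_cond measure_pmf_single c)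
  qed
qed

context
  fixes H :: "'a point pmf \<Rightarrow> 'w::ordered_ab_group_add"
  assumes H: "point_entropy H"
begin

interpretation point_entropy H by (rule H)

text \<open>Each atom of \<open>X\<close> meets at most two intervals of \<open>Y\<close>, and these
  are neighbours, so the parity of the index recovers \<open>Y\<close> from \<open>X\<close> at the
  price of one bit.\<close>

lemma exists_cheap_coupling:
  fixes X :: "'b pmf" and Y :: "'c pmf"
  assumes X: "finite (set_pmf X)" and Y: "finite (set_pmf Y)"
    and X_le: "\<And>x. pmf X x \<le> \<theta>" and Y_ge: "\<And>y. y \<in> set_pmf Y \<Longrightarrow> \<theta> \<le> pmf Y y"
  shows "\<exists>J. finite (set_pmf J) \<and> map_pmf fst J = X \<and> map_pmf snd J = Y \<and>
    ent H J \<le> ent H X + ent H (unif 2)"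
proof -
  obtain f where f: "bij_betw f (set_pmf X) {..<card (set_pmf X)}"
    using ex_bij_betw_finite_nat[OF X] by (auto simp: atLeast0LessThan)
  obtain g where g: "bij_betw g (set_pmf Y) {..<card (set_pmf Y)}"
    using ex_bij_betw_finite_nat[OF Y] by (auto simp: atLeast0LessThan)
  have inj: "inj_on f (set_pmf X)" "inj_on g (set_pmf Y)"
    using f g by (simp_all add: bij_betw_def)
  have "\<exists>J. finite (set_pmf J) \<and> map_pmf fst J = map_pmf f X \<and> map_pmf snd J = map_pmf g Y \<and>
    (\<forall>i j j'. (i, j) \<in> set_pmf J \<longrightarrow> (i, j') \<in> set_pmf J \<longrightarrow> j' \<le> Suc j)"
  proof (rule exists_interval_coupling)
    show set_fX: "set_pmf (map_pmf f X) = {..<card (set_pmf X)}"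
      and set_gY: "set_pmf (map_pmf g Y) = {..<card (set_pmf Y)}"
      using f g by (simp_all add: bij_betw_def)
    have "0 \<le> \<theta>" by (rule order_trans[OF pmf_nonneg X_le])
    then show "pmf (map_pmf f X) i \<le> \<theta>" for i
      using X_le by (cases "i \<in> f ` set_pmf X") (auto simp: pmf_map_inj[OF inj(1)] pmf_map_outside)
    show "\<theta> \<le> pmf (map_pmf g Y) j" if "j < card (set_pmf Y)" for j
    proof -
      have "j \<in> g ` set_pmf Y" using that set_gY by auto
      then show ?thesis using Y_ge by (auto simp: pmf_map_inj[OF inj(2)])
    qed
  qed
  then obtain J where J: "finite (set_pmf J)" "map_pmf fst J = map_pmf f X" "map_pmf snd J = map_pmf g Y"
    "\<And>i j j'. (i, j) \<in> set_pmf J \<Longrightarrow> (i, j') \<in> set_pmf J \<Longrightarrow> j' \<le> Suc j"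
    by blast
  define K where "K = map_pmf (map_prod (inv_into (set_pmf X) f) (inv_into (set_pmf Y) g)) J"
  have "map_pmf fst K = map_pmf (inv_into (set_pmf X) f) (map_pmf fst J)"
    by (simp add: K_def map_pmf_comp)
  also have "\<dots> = X" using map_pmf_inv_into[OF inj(1), of "\<lambda>x. x"] by (simp add: J(2))
  finally have "map_pmf fst K = X" .
  moreover have "map_pmf snd K = Y"
  proof -
    have "map_pmf snd K = map_pmf (inv_into (set_pmf Y) g) (map_pmf snd J)"
      by (simp add: K_def map_pmf_comp)
    also have "\<dots> = Y" using map_pmf_inv_into[OF inj(2), of "\<lambda>x. x"] by (simp add: J(3))
    finally show ?thesis .
  qed
  moreover have "ent H K \<le> ent H X + ent H (unif 2)"
  proof -
    have "inj_on (\<lambda>z. (fst z, even (snd z))) (set_pmf J)"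
    proof (rule inj_onI, clarsimp)
      fix i j j' assume z: "(i, j) \<in> set_pmf J" "(i, j') \<in> set_pmf J" and "even j = even j'"
      moreover have "j' \<le> Suc j" "j \<le> Suc j'" using J(4) z by blast+
      ultimately show "j = j'" by (metis even_Suc le_SucE le_antisym)
    qed
    then have "ent H J \<le> ent H (map_pmf fst J) + ent H (map_pmf (\<lambda>z. even (snd z)) J)"
      by (rule ent_le_add[OF J(1)])
    also have "ent H (map_pmf (\<lambda>z. even (snd z)) J) \<le> ent H (unif 2)"
      using card_mono[of "UNIV :: bool set"] by (intro ent_le_unif[OF H]) (simp_all add: J(1))
    also have "ent H (map_pmf fst J) = ent H X"
      using J(2) inj X by (simp add: ent_map_inj)
    finally have "ent H J \<le> ent H X + ent H (unif 2)" by simp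
    with ent_map_le[OF J(1)] show ?thesis unfolding K_def by (rule order_trans)
  qed
  moreover have "finite (set_pmf K)" by (simp add: K_def J(1))
  ultimately show ?thesis by blast
qed

text \<open>Flattening the heavy atoms together with the lightest ones, of total mass at most \<open>1 / q\<close>.\<close>

lemma exists_spread:
  fixes X :: "'b pmf"
  assumes X: "finite (set_pmf X)" and q: "q \<ge> 2" and \<theta>: "\<theta> > 0"
    and heavy: "measure X {x. pmf X x > \<theta>} \<le> 1 / (2 * real q)"
    and card: "2 * real q + 2 / \<theta> \<le> real (card (set_pmf X))"
  shows "\<exists>X' :: ('b + 'b) pmf. finite (set_pmf X') \<and> card (set_pmf X') = card (set_pmf X) \<and>
    (\<forall>z. pmf X' z \<le> \<theta>) \<and>
    nmult q (ent H X') \<le> nmult q (ent H X) + ent H (unif (card (set_pmf X)))"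
proof -
  define n where "n = card (set_pmf X)"
  \<comment> \<open>A suitable set of \<open>k\<close> atoms weighs at most
    \<open>k / n \<le> 1 / (2 q)\<close>, which together with the heavy atoms makes
    \<open>t \<le> 1 / q\<close>. The hypothesis on the cardinality gives
    \<open>1 / q \<le> \<theta> * k\<close>, so spreading the mass \<open>t\<close> evenly over at
    least \<open>k\<close> atoms leaves each of them at most \<open>\<theta>\<close>.\<close>
  define k where "k = n div (2 * q)"
  have "real n < real (2 * q * (k + 1))"
    unfolding of_nat_less_iff k_def using q dividend_less_times_div[of "2 * q" n] by simp
  then have nk: "real n < 2 * real q * (real k + 1)" by (simp add: algebra_simps)
  have "1 / \<theta> \<le> real q * real k" using nk card by (simp add: n_def algebra_simps)
  then have k\<theta>: "1 / real q \<le> \<theta> * real k" using \<theta> q by (simp add: field_simps)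
  have k0: "k > 0" using k\<theta> q by (cases k) (auto simp: divide_le_0_iff)
  have kn: "2 * real q * real k \<le> real n"
  proof -
    have "2 * q * k \<le> n" unfolding k_def by simp
    then have "real (2 * q * k) \<le> real n" by (rule of_nat_mono)
    then show ?thesis by simp
  qed
  have n0: "n > 0" unfolding n_def by (rule card_set_pmf_pos[OF X])
  obtain K where K: "K \<subseteq> set_pmf X" "card K = k" "real n * sum (pmf X) K \<le> real k * sum (pmf X) (set_pmf X)"
    using exists_light_subset[OF X, of k "pmf X"] unfolding n_def k_def by (auto simp: n_def k_def)
  have finK: "finite K" using K(1) X finite_subset by blast
  have "sum (pmf X) (set_pmf X) = 1" using X by (simp add: sum_pmf_eq_1)
  then have "sum (pmf X) K \<le> real k / real n" using K(3) n0 by (simp add: field_simps)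
  also have "\<dots> \<le> 1 / (2 * real q)" using kn n0 q by (simp add: field_simps)
  finally have mK: "measure X K \<le> 1 / (2 * real q)" using finK by (simp add: measure_measure_pmf_finite)
  define E where "E = {x \<in> set_pmf X. pmf X x > \<theta>} \<union> K"
  define t where "t = measure X E"
  have E: "E \<subseteq> set_pmf X" "finite E" using K(1) X finite_subset by (auto simp: E_def)
  have neE: "E \<noteq> {}" using k0 K(2) by (auto simp: E_def)
  then obtain x where x: "x \<in> E" by blast
  have "0 < pmf X x" using x E by (auto simp: pmf_positive)
  also have "\<dots> \<le> t" unfolding t_def using x by (simp add: measure_pmf_single[symmetric] measure_pmf.finite_measure_mono)
  finally have t0: "t > 0" .
  have "t \<le> measure X {x \<in> set_pmf X. pmf X x > \<theta>} + measure X K"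
    unfolding t_def E_def by (intro measure_Un_le) auto
  also have "measure X {x \<in> set_pmf X. pmf X x > \<theta>} \<le> measure X {x. pmf X x > \<theta>}"
    by (intro measure_pmf.finite_measure_mono) auto
  also have "measure X {x. pmf X x > \<theta>} + measure X K \<le> 1 / (2 * real q) + 1 / (2 * real q)"
    by (rule add_mono[OF heavy mK])
  also have "\<dots> = 1 / real q" using q by (simp add: field_simps)
  finally have tq: "t \<le> 1 / real q" by simp
  also have "\<dots> < 1" using q by simp
  finally have t1: "t < 1" .
  have ne: "set_pmf X \<inter> E \<noteq> {}" "set_pmf X \<inter> - E \<noteq> {}"
  proof -
    show "set_pmf X \<inter> E \<noteq> {}" using x E by auto
    show "set_pmf X \<inter> - E \<noteq> {}"
      using t1 measure_pmf.prob_eq_1[of E X] by (auto simp: t_def AE_measure_pmf_iff)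
  qed
  let ?R = "cond_pmf X E" and ?S = "cond_pmf X (- E)"
  have set_R: "set_pmf ?R = E" using ne E by auto
  define X' where "X' = disjoint_mixture t (pmf_of_set E) ?S"
  have U: "set_pmf (pmf_of_set E) = E" using E(2) neE by simp
  have set_X': "set_pmf X' = Inl ` E \<union> Inr ` (set_pmf X - E)"
    unfolding X'_def using t0 t1 U ne by (subst set_disjoint_mixture) auto
  have "card (set_pmf X') = card (Inl ` E :: ('b + 'b) set) + card (Inr ` (set_pmf X - E) :: ('b + 'b) set)"
    unfolding set_X' using X E by (intro card_Un_disjoint) auto
  also have "\<dots> = card (set_pmf X)"
    using E X card_mono[OF X E(1)] by (simp add: card_image card_Diff_subset)
  finally have card_X': "card (set_pmf X') = card (set_pmf X)" .
  have le: "pmf X' z \<le> \<theta>" for z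
  proof (cases z)
    case (Inl y)
    have "real k \<le> real (card E)" unfolding K(2)[symmetric] using E(2) by (auto simp: E_def intro: card_mono)
    then have "\<theta> * real k \<le> \<theta> * real (card E)" using \<theta> by simp
    then have "t \<le> \<theta> * real (card E)" using tq k\<theta> by linarith
    moreover have "card E > 0" using E x by (auto simp: card_gt_0_iff)
    ultimately have "t / real (card E) \<le> \<theta>" by (simp add: field_simps)
    then show ?thesis
      using t0 t1 E(2) neE \<theta> unfolding Inl X'_def
      by (simp add: pmf_disjoint_mixture indicator_def)
  next
    case (Inr y)
    have "measure X (- E) = 1 - t"
      using measure_pmf.prob_compl[of E X] by (simp add: Compl_eq_Diff_UNIV t_def)
    then have "pmf X' z = (if y \<in> E then 0 else pmf X y)"
      using t0 t1 ne unfolding Inr X'_def by (simp add: pmf_disjoint_mixture pmf_cond)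
    also have "\<dots> \<le> \<theta>"
      using \<theta> by (cases "y \<in> set_pmf X") (auto simp: E_def set_pmf_iff)
    finally show ?thesis .
  qed
  have "ent H X = ent H (map_pmf (\<lambda>x. if x \<in> E then Inl x else Inr x) X)"
    using X by (intro ent_map_inj[symmetric]) (auto simp: inj_on_def)
  also have "\<dots> = ent H (disjoint_mixture t ?R ?S)"
    using t0 t1 unfolding t_def by (simp add: map_pmf_split_event)
  finally have "nmult q (ent H X') \<le> nmult q (ent H X) + ent H (pmf_of_set E)"
    using ent_flatten_le[OF H, of ?R ?S t q] set_R E X ne t0 tq q
    by (simp add: X'_def field_simps)
  also have "ent H (pmf_of_set E) \<le> ent H (unif (card (set_pmf X)))"
    using U E X by (intro ent_le_unif[OF H]) (simp_all add: card_mono)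
  finally show ?thesis using card_X' le set_X' E X by (intro exI[of _ X']) auto
qed

text \<open>The light part of \<open>Y\<close> is replaced by an image of \<open>X\<close>; the rest
  \<open>B\<close>, whose atoms are at least \<open>\<theta>\<close>, is obtained from
  \<open>X\<close> by the cheap coupling. One bit pays for the coupling, the other selects the
  component. Making the light part uniform only raises the entropy; comparing the uniform part with
  the image of \<open>X\<close> is a flattening and costs the last term.\<close>

lemma ent_le_of_spread:
  fixes X :: "'b pmf" and Y :: "'c pmf"
  assumes X: "finite (set_pmf X)" and Y: "finite (set_pmf Y)" and q: "q \<ge> 2"
    and X_le: "\<And>x. pmf X x \<le> \<theta>"
    and light: "measure Y {y. pmf Y y < \<theta>} \<le> 1 / real q"
    and card: "card (set_pmf Y) \<le> card (set_pmf X)"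
  shows "nmult q (ent H Y)
    \<le> nmult q (ent H X + ent H (unif 2) + ent H (unif 2)) + ent H (unif (card (set_pmf Y)))"
proof -
  define E where "E = {y \<in> set_pmf Y. pmf Y y < \<theta>}"
  define t where "t = measure Y E"
  have E: "E \<subseteq> set_pmf Y" "finite E" using Y finite_subset by (auto simp: E_def)
  have L0: "0 \<le> ent H (unif n)" if "n > 0" for n
    using that by (intro ent_nonneg) simp
  have cY: "card (set_pmf Y) > 0" by (rule card_set_pmf_pos[OF Y])
  have t1: "t < 1"
  proof -
    have "t \<le> measure Y {y. pmf Y y < \<theta>}"
      unfolding t_def by (intro measure_pmf.finite_measure_mono) (auto simp: E_def)
    also have "\<dots> \<le> 1 / real q" by (rule light)
    also have "\<dots> < 1" using q by simp
    finally show ?thesis .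
  qed
  have tq: "t * real q \<le> 1"
  proof -
    have "t \<le> measure Y {y. pmf Y y < \<theta>}"
      unfolding t_def by (intro measure_pmf.finite_measure_mono) (auto simp: E_def)
    with light have "t \<le> 1 / real q" by simp
    then show ?thesis using q by (simp add: field_simps)
  qed
  have neC: "set_pmf Y \<inter> - E \<noteq> {}"
    using t1 measure_pmf.prob_eq_1[of E Y] by (auto simp: t_def AE_measure_pmf_iff)
  show ?thesis
  \<comment> \<open>Conditioning on an event of mass zero is meaningless, so an empty
    \<open>E\<close> is treated apart.\<close>
  proof (cases "E = {}")
    case True
    have Y_ge: "\<theta> \<le> pmf Y y" if "y \<in> set_pmf Y" for y
      using True that by (force simp: E_def not_less)
    have "\<exists>J. finite (set_pmf J) \<and> map_pmf fst J = X \<and> map_pmf snd J = Y \<and>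
      ent H J \<le> ent H X + ent H (unif 2)"
      by (rule exists_cheap_coupling[OF X Y X_le]) (rule Y_ge)
    then obtain J where J: "finite (set_pmf J)" "map_pmf fst J = X" "map_pmf snd J = Y"
      "ent H J \<le> ent H X + ent H (unif 2)" by blast
    have "ent H Y \<le> ent H J" using ent_map_le[OF J(1), of snd] J(3) by simp
    also have "\<dots> \<le> ent H X + ent H (unif 2) + ent H (unif 2)"
      using J(4) L0[of 2] by (simp add: add_increasing2)
    finally have "nmult q (ent H Y) \<le> nmult q (ent H X + ent H (unif 2) + ent H (unif 2))"
      by (rule nmult_mono)
    then show ?thesis using L0[OF cY] by (simp add: add_increasing2)
  next
    case False
    then obtain y where y: "y \<in> E" by blast
    have "0 < pmf Y y" using y E by (auto simp: pmf_positive)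
    also have "\<dots> \<le> t" unfolding t_def using y
      by (simp add: measure_pmf_single[symmetric] measure_pmf.finite_measure_mono)
    finally have t0: "t > 0" .
    have ne: "set_pmf Y \<inter> E \<noteq> {}" using y E by auto
    define R where "R = cond_pmf Y E"
    define B where "B = cond_pmf Y (- E)"
    have set_R: "set_pmf R = E" using ne E by (auto simp: R_def)
    have finR: "finite (set_pmf R)" using set_R E by simp
    have set_B: "set_pmf B = set_pmf Y - E" using neC by (auto simp: B_def)
    have finB: "finite (set_pmf B)" using set_B Y by simp
    have U: "set_pmf (pmf_of_set E) = E" using E(2) False by simp
    have "card E \<le> card (set_pmf X)" using card_mono[OF Y E(1)] card by simp
    then obtain h where h: "inj_on h E" "h ` E \<subseteq> set_pmf X"
      using card_le_inj[OF E(2) X] by blast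
    \<comment> \<open>A left inverse of \<open>h\<close>, constant off its range: the image of
      \<open>X\<close> then has all of \<open>E\<close> as its support, and flattening it produces
      the uniform distribution on \<open>E\<close>.\<close>
    define \<sigma> where "\<sigma> x = (if x \<in> h ` E then inv_into E h x else y)" for x
    have \<sigma>: "\<sigma> ` set_pmf X = E"
    proof
      show "\<sigma> ` set_pmf X \<subseteq> E" using y h by (auto simp: \<sigma>_def)
      have "e = \<sigma> (h e)" if "e \<in> E" for e using that h by (simp add: \<sigma>_def)
      then show "E \<subseteq> \<sigma> ` set_pmf X" using h(2) by blast
    qed
    have "\<exists>J. finite (set_pmf J) \<and> map_pmf fst J = X \<and> map_pmf snd J = B \<and>
      ent H J \<le> ent H X + ent H (unif 2)"
    proof (rule exists_cheap_coupling[OF X finB X_le])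
      fix b assume b: "b \<in> set_pmf B"
      have "measure Y (- E) = 1 - t"
        using measure_pmf.prob_compl[of E Y] by (simp add: Compl_eq_Diff_UNIV t_def)
      then have "pmf B b = pmf Y b / (1 - t)" using b set_B neC by (simp add: B_def pmf_cond)
      moreover have "\<dots> \<ge> pmf Y b" using t0 t1 by (simp add: field_simps pmf_nonneg)
      moreover have "pmf Y b \<ge> \<theta>" using b set_B by (auto simp: E_def)
      ultimately show "\<theta> \<le> pmf B b" by simp
    qed
    then obtain J where J: "finite (set_pmf J)" "map_pmf fst J = X" "map_pmf snd J = B"
      "ent H J \<le> ent H X + ent H (unif 2)" by blast
    let ?h = "\<lambda>(b, z). if b then Inl (\<sigma> (fst z)) else Inr (snd z)"
    have "map_pmf ?h (pair_pmf (bernoulli_pmf t) J) = bind_pmf (bernoulli_pmf t) (\<lambda>b. map_pmf (\<lambda>z. ?h (b, z)) J)"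
      by (simp add: pair_pmf_def map_bind_pmf map_pmf_def bind_assoc_pmf bind_return_pmf)
    also have "\<dots> = bind_pmf (bernoulli_pmf t) (\<lambda>b. if b then map_pmf Inl (map_pmf \<sigma> (map_pmf fst J))
        else map_pmf Inr (map_pmf snd J))"
      by (intro bind_pmf_cong) (auto simp: map_pmf_comp)
    also have "\<dots> = disjoint_mixture t (map_pmf \<sigma> X) B"
      unfolding disjoint_mixture_def mixture_def J ..
    finally have "ent H (disjoint_mixture t (map_pmf \<sigma> X) B) \<le> ent H (pair_pmf (bernoulli_pmf t) J)"
      using ent_map_le[of "pair_pmf (bernoulli_pmf t) J" ?h] J(1) by simp
    also have "\<dots> = ent H (bernoulli_pmf t) + ent H J" using J(1) by (simp add: ent_pair)
    also have "\<dots> \<le> ent H (unif 2) + (ent H X + ent H (unif 2))"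
      using card_mono[of "UNIV :: bool set"] by (intro add_mono J(4) ent_le_unif[OF H]) simp_all
    finally have upper: "ent H (disjoint_mixture t (map_pmf \<sigma> X) B) \<le> ent H X + ent H (unif 2) + ent H (unif 2)"
      by (simp add: ac_simps)
    have "ent H Y = ent H (map_pmf (\<lambda>y. if y \<in> E then Inl y else Inr y) Y)"
      using Y by (intro ent_map_inj[symmetric]) (auto simp: inj_on_def)
    also have "\<dots> = ent H (disjoint_mixture t R B)"
      using t0 t1 unfolding t_def R_def B_def by (simp add: map_pmf_split_event)
    also have "\<dots> \<le> ent H (disjoint_mixture t (pmf_of_set E) B)"
    proof -
      have "ent H (disjoint_mixture t R B) + ent H (pmf_of_set E)
          \<le> ent H (disjoint_mixture t (pmf_of_set E) B) + ent H (mixture t R (pmf_of_set E))"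
        by (intro ent_swap finR finB) (simp add: U E)
      also have "ent H (mixture t R (pmf_of_set E)) \<le> ent H (pmf_of_set E)"
        using set_mixture_subset[of t R "pmf_of_set E"] U set_R E by (intro ent_le_pmf_of_set[OF H]) auto
      finally show ?thesis by simp
    qed
    finally have "nmult q (ent H Y) \<le> nmult q (ent H (disjoint_mixture t (pmf_of_set E) B))"
      by (rule nmult_mono)
    also have "\<dots> \<le> nmult q (ent H (disjoint_mixture t (map_pmf \<sigma> X) B)) + ent H (pmf_of_set E)"
      using ent_flatten_le[OF H, of "map_pmf \<sigma> X" B t q] E(2) X finB t0 tq q \<sigma> by simp
    also have "\<dots> \<le> nmult q (ent H X + ent H (unif 2) + ent H (unif 2)) + ent H (unif (card (set_pmf Y)))"
      using U E Y by (intro add_mono nmult_mono upper ent_le_unif[OF H]) (simp_all add: card_mono)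
    finally show ?thesis .
  qed
qed

end

section \<open>Shannon and Hartley entropy\<close>

lemma sum_set_map_pmf:
  fixes g :: "'c \<Rightarrow> real"
  assumes "finite (set_pmf p)"
  shows "(\<Sum>y\<in>set_pmf (map_pmf f p). pmf (map_pmf f p) y * g y) = (\<Sum>x\<in>set_pmf p. pmf p x * g (f x))"
proof -
  have "(\<Sum>y\<in>set_pmf (map_pmf f p). pmf (map_pmf f p) y * g y) = measure_pmf.expectation (map_pmf f p) g"
    using assms by (subst integral_measure_pmf_real[of "set_pmf (map_pmf f p)"]) (auto simp: mult.commute)
  also have "\<dots> = measure_pmf.expectation p (\<lambda>x. g (f x))" by (rule integral_map_pmf)
  also have "\<dots> = (\<Sum>x\<in>set_pmf p. pmf p x * g (f x))"
    using assms by (subst integral_measure_pmf_real[of "set_pmf p"]) (auto simp: mult.commute)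
  finally show ?thesis .
qed

lemma H1_map_pmf:
  assumes "finite (set_pmf p)"
  shows "H1 (map_pmf f p) = - (\<Sum>x\<in>set_pmf p. pmf p x * ln (pmf (map_pmf f p) (f x)))"
  unfolding H1_def by (simp only: sum_set_map_pmf[OF assms])

lemma pmf_le_pmf_map: "pmf p x \<le> pmf (map_pmf f p) (f x)"
  using measure_pmf.finite_measure_mono[of "{x}" "f -` {f x}" p]
  by (simp add: pmf_map measure_pmf_single)

lemma H1_mono:
  assumes "finite (set_pmf p)"
  shows "H1 (map_pmf f p) \<le> H1 p"
  unfolding H1_map_pmf[OF assms] unfolding H1_def
  by (intro le_imp_neg_le sum_mono mult_left_mono) (auto simp: pmf_positive pmf_le_pmf_map)

text \<open>Mutual information is nonnegative: \<open>ln x \<le> x - 1\<close> for the ratio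
  \<open>g\<close> of the product of the marginals to the joint distribution.\<close>

lemma H1_subadditive:
  assumes fin: "finite (set_pmf p)"
  shows "H1 (map_pmf (\<lambda>x. Tup (X x) (Y x)) p) \<le> H1 (map_pmf X p) + H1 (map_pmf Y p)"
proof -
  let ?X = "map_pmf X p" and ?Y = "map_pmf Y p"
  define J where "J = map_pmf (\<lambda>x. (X x, Y x)) p"
  define g where "g z = pmf ?X (fst z) * pmf ?Y (snd z) / pmf J z" for z
  have JT: "map_pmf (\<lambda>x. Tup (X x) (Y x)) p = map_pmf (\<lambda>(a, b). Tup a b) J"
    by (simp add: J_def map_pmf_comp)
  have inj: "inj (\<lambda>(a, b). Tup a b)" by (auto simp: inj_def)
  have JT_pmf: "pmf (map_pmf (\<lambda>x. Tup (X x) (Y x)) p) (Tup (X x) (Y x)) = pmf J (X x, Y x)" for x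
    using pmf_map_inj'[OF inj, of J "(X x, Y x)"] by (simp add: JT)
  have "- H1 ?X - H1 ?Y + H1 (map_pmf (\<lambda>x. Tup (X x) (Y x)) p)
      = (\<Sum>x\<in>set_pmf p. pmf p x * (ln (pmf ?X (X x)) + ln (pmf ?Y (Y x)) - ln (pmf J (X x, Y x))))"
    unfolding H1_map_pmf[OF fin] JT_pmf by (simp add: sum.distrib sum_subtractf distrib_left right_diff_distrib)
  also have "\<dots> \<le> (\<Sum>x\<in>set_pmf p. pmf p x * (g (X x, Y x) - 1))"
  proof (intro sum_mono mult_left_mono)
    fix x assume x: "x \<in> set_pmf p"
    then have pos: "0 < pmf ?X (X x)" "0 < pmf ?Y (Y x)" "0 < pmf J (X x, Y x)"
      unfolding J_def by (auto intro!: pmf_positive)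
    then have "ln (pmf ?X (X x)) + ln (pmf ?Y (Y x)) - ln (pmf J (X x, Y x)) = ln (g (X x, Y x))"
      by (simp add: g_def ln_div ln_mult)
    also have "\<dots> \<le> g (X x, Y x) - 1"
      using pos by (intro ln_le_minus_one) (simp add: g_def)
    finally show "ln (pmf ?X (X x)) + ln (pmf ?Y (Y x)) - ln (pmf J (X x, Y x)) \<le> g (X x, Y x) - 1" .
  qed simp
  also have "\<dots> = (\<Sum>z\<in>set_pmf J. pmf J z * (g z - 1))"
    unfolding J_def by (rule sum_set_map_pmf[OF fin, symmetric])
  also have "\<dots> = (\<Sum>z\<in>set_pmf J. pmf ?X (fst z) * pmf ?Y (snd z)) - 1"
  proof -
    have "pmf J z * (g z - 1) = pmf ?X (fst z) * pmf ?Y (snd z) - pmf J z" if "z \<in> set_pmf J" for z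
      using that by (simp add: g_def right_diff_distrib set_pmf_iff)
    moreover have "sum (pmf J) (set_pmf J) = 1" using fin by (intro sum_pmf_eq_1) (simp_all add: J_def)
    ultimately show ?thesis by (simp add: sum_subtractf)
  qed
  \<comment> \<open>The product of the marginals may charge pairs outside the support of
    \<open>J\<close>.\<close>
  also have "(\<Sum>z\<in>set_pmf J. pmf ?X (fst z) * pmf ?Y (snd z))
      \<le> (\<Sum>z\<in>set_pmf ?X \<times> set_pmf ?Y. pmf ?X (fst z) * pmf ?Y (snd z))"
    using fin by (intro sum_mono2) (auto simp: J_def)
  also have "\<dots> = sum (pmf ?X) (set_pmf ?X) * sum (pmf ?Y) (set_pmf ?Y)"
    by (simp add: sum_product sum.cartesian_product case_prod_beta)
  also have "\<dots> = 1" using fin by (simp add: sum_pmf_eq_1)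
  finally show ?thesis by simp
qed

lemma pmf_tensor: "pmf (P \<otimes>\<^sub>o Q) (Tup x y) = pmf P x * pmf Q y"
proof -
  have inj: "inj (\<lambda>(a, b). Tup a b)" by (auto simp: inj_def)
  show ?thesis
    using pmf_map_inj'[OF inj, of "pair_pmf P Q" "(x, y)"] by (simp add: tensor_obj_def pmf_pair)
qed

lemma sum_tensor:
  fixes g :: "'a point \<Rightarrow> real"
  assumes "P \<in> FinProb" "Q \<in> FinProb"
  shows "(\<Sum>z\<in>set_pmf (P \<otimes>\<^sub>o Q). pmf (P \<otimes>\<^sub>o Q) z * g z)
    = (\<Sum>x\<in>set_pmf P. \<Sum>y\<in>set_pmf Q. pmf P x * pmf Q y * g (Tup x y))"
proof -
  have "(\<Sum>z\<in>set_pmf (P \<otimes>\<^sub>o Q). pmf (P \<otimes>\<^sub>o Q) z * g z)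
      = (\<Sum>z\<in>set_pmf P \<times> set_pmf Q. pmf (pair_pmf P Q) z * g (case z of (x, y) \<Rightarrow> Tup x y))"
    unfolding tensor_obj_def using assms by (subst sum_set_map_pmf) (simp_all add: FinProb_def)
  also have "\<dots> = (\<Sum>(x, y)\<in>set_pmf P \<times> set_pmf Q. pmf P x * pmf Q y * g (Tup x y))"
    by (intro sum.cong) (auto simp: pmf_pair)
  finally show ?thesis by (simp add: sum.cartesian_product)
qed

lemma sum_pmf_FinProb: "P \<in> FinProb \<Longrightarrow> sum (pmf P) (set_pmf P) = 1"
  by (simp add: FinProb_def sum_pmf_eq_1)

lemma H1_tensor:
  assumes P: "P \<in> FinProb" and Q: "Q \<in> FinProb"
  shows "H1 (P \<otimes>\<^sub>o Q) = H1 P + H1 Q"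
proof -
  have "- H1 (P \<otimes>\<^sub>o Q) = (\<Sum>x\<in>set_pmf P. \<Sum>y\<in>set_pmf Q. pmf P x * pmf Q y * (ln (pmf P x) + ln (pmf Q y)))"
    unfolding H1_def minus_minus sum_tensor[OF P Q]
    by (intro sum.cong refl) (simp add: pmf_tensor ln_mult pmf_positive set_pmf_iff[symmetric])
  also have "\<dots> = (\<Sum>x\<in>set_pmf P. pmf P x * ln (pmf P x)) * (\<Sum>y\<in>set_pmf Q. pmf Q y)
      + (\<Sum>x\<in>set_pmf P. pmf P x) * (\<Sum>y\<in>set_pmf Q. pmf Q y * ln (pmf Q y))"
    unfolding sum_product sum.distrib[symmetric] by (simp add: algebra_simps)
  finally show ?thesis using P Q by (simp add: sum_pmf_FinProb) (simp add: H1_def)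
qed

text \<open>The variance of the information content; the mean of \<open>ln (pmf P x)\<close> is
  \<open>- H1 P\<close>, hence the plus sign.\<close>

definition info_variance :: "'a point pmf \<Rightarrow> real" where
  "info_variance P = (\<Sum>x\<in>set_pmf P. pmf P x * (ln (pmf P x) + H1 P)\<^sup>2)"

lemma info_variance_nonneg: "0 \<le> info_variance P"
  by (simp add: info_variance_def sum_nonneg)

text \<open>Information contents of independent outcomes add, and the cross term vanishes because
  \<open>f\<close> has mean zero.\<close>

lemma info_variance_tensor:
  assumes P: "P \<in> FinProb" and Q: "Q \<in> FinProb"
  shows "info_variance (P \<otimes>\<^sub>o Q) = info_variance P + info_variance Q"
proof -
  define f where "f x = ln (pmf P x) + H1 P" for x
  define g where "g y = ln (pmf Q y) + H1 Q" for y
  have f0: "(\<Sum>x\<in>set_pmf P. pmf P x * f x) = 0"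
    using P by (simp add: f_def distrib_left sum.distrib sum_pmf_FinProb flip: sum_distrib_right)
      (simp add: H1_def)
  have "info_variance (P \<otimes>\<^sub>o Q)
      = (\<Sum>x\<in>set_pmf P. \<Sum>y\<in>set_pmf Q. pmf P x * pmf Q y * (f x + g y)\<^sup>2)"
    unfolding info_variance_def sum_tensor[OF P Q] H1_tensor[OF P Q]
    by (intro sum.cong refl)
      (simp add: pmf_tensor ln_mult pmf_positive f_def g_def algebra_simps set_pmf_iff[symmetric])
  also have "\<dots> = (\<Sum>x\<in>set_pmf P. pmf P x * (f x)\<^sup>2) * (\<Sum>y\<in>set_pmf Q. pmf Q y)
      + 2 * ((\<Sum>x\<in>set_pmf P. pmf P x * f x) * (\<Sum>y\<in>set_pmf Q. pmf Q y * g y))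
      + (\<Sum>x\<in>set_pmf P. pmf P x) * (\<Sum>y\<in>set_pmf Q. pmf Q y * (g y)\<^sup>2)"
    unfolding sum_product sum_distrib_left[of 2] sum.distrib[symmetric]
    by (simp add: algebra_simps power2_eq_square)
  finally show ?thesis
    using P Q by (simp add: f0 sum_pmf_FinProb) (simp add: info_variance_def f_def g_def)
qed

lemma info_chebyshev:
  assumes P: "P \<in> FinProb" and \<epsilon>: "\<epsilon> > 0"
  shows "measure P {x. \<epsilon> \<le> \<bar>ln (pmf P x) + H1 P\<bar>} \<le> info_variance P / \<epsilon>\<^sup>2"
proof -
  let ?B = "{x \<in> set_pmf P. \<epsilon> \<le> \<bar>ln (pmf P x) + H1 P\<bar>}"
  have fin: "finite (set_pmf P)" using P by (simp add: FinProb_def)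
  \<comment> \<open>Points outside the support may satisfy the condition through the default value
    of \<open>ln 0\<close>; they carry no mass.\<close>
  have "measure P {x. \<epsilon> \<le> \<bar>ln (pmf P x) + H1 P\<bar>} = measure P ({x. \<epsilon> \<le> \<bar>ln (pmf P x) + H1 P\<bar>} \<inter> set_pmf P)"
    by (rule measure_Int_set_pmf[symmetric])
  also have "{x. \<epsilon> \<le> \<bar>ln (pmf P x) + H1 P\<bar>} \<inter> set_pmf P = ?B" by auto
  also have "measure P ?B = sum (pmf P) ?B" using fin by (simp add: measure_measure_pmf_finite)
  finally have eq: "measure P {x. \<epsilon> \<le> \<bar>ln (pmf P x) + H1 P\<bar>} = sum (pmf P) ?B" .
  have "sum (pmf P) ?B * \<epsilon>\<^sup>2 = (\<Sum>x\<in>?B. pmf P x * \<epsilon>\<^sup>2)" by (rule sum_distrib_right)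
  also have "\<dots> \<le> (\<Sum>x\<in>?B. pmf P x * (ln (pmf P x) + H1 P)\<^sup>2)"
    using \<epsilon> by (intro sum_mono mult_left_mono) (auto simp: abs_le_square_iff[symmetric])
  also have "\<dots> \<le> info_variance P"
    unfolding info_variance_def using fin by (intro sum_mono2) auto
  finally show ?thesis using \<epsilon> unfolding eq by (simp add: field_simps)
qed

lemma H1_nonneg: "0 \<le> H1 P"
proof -
  have "pmf P x * ln (pmf P x) \<le> 0" if "x \<in> set_pmf P" for x
    using that pmf_le_1[of P x] by (simp add: mult_nonneg_nonpos pmf_positive)
  then show ?thesis unfolding H1_def by (simp add: sum_nonpos)
qed

text \<open>Again \<open>ln x \<le> x - 1\<close>, now against the uniform distribution. It ensures
  that for \<open>c < H1 P\<close> the support of a high power of \<open>P\<close> far exceeds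
  \<open>exp (N c)\<close>, as \<open>exists_spread\<close> requires.\<close>

lemma H1_le_H0:
  assumes "P \<in> FinProb"
  shows "H1 P \<le> H0 P"
proof -
  let ?n = "real (card (set_pmf P))"
  have fin: "finite (set_pmf P)" using assms by (simp add: FinProb_def)
  have n: "?n > 0" using card_set_pmf_pos[OF fin] by simp
  have "H1 P - H0 P = (\<Sum>x\<in>set_pmf P. pmf P x * (- ln (pmf P x) - ln ?n))"
    using sum_pmf_FinProb[OF assms]
    by (simp add: H1_def H0_def right_diff_distrib sum_subtractf sum_negf flip: sum_distrib_right)
  also have "\<dots> \<le> (\<Sum>x\<in>set_pmf P. pmf P x * (1 / (pmf P x * ?n) - 1))"
  proof (intro sum_mono mult_left_mono)
    fix x assume "x \<in> set_pmf P"
    then have x: "pmf P x > 0" by (rule pmf_positive)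
    have "- ln (pmf P x) - ln ?n = ln (1 / (pmf P x * ?n))" using x n by (simp add: ln_div ln_mult)
    also have "\<dots> \<le> 1 / (pmf P x * ?n) - 1" using x n by (intro ln_le_minus_one) simp
    finally show "- ln (pmf P x) - ln ?n \<le> 1 / (pmf P x * ?n) - 1" .
  qed simp
  also have "\<dots> = (\<Sum>x\<in>set_pmf P. 1 / ?n - pmf P x)"
    by (intro sum.cong refl) (simp add: right_diff_distrib set_pmf_iff)
  also have "\<dots> = 0" using sum_pmf_FinProb[OF assms] n by (simp add: sum_subtractf)
  finally show ?thesis by simp
qed

section \<open>Hartley entropy, Shannon entropy and their pair satisfy the laws\<close>

lemma set_tensor: "set_pmf (P \<otimes>\<^sub>o Q) = (\<lambda>(x, y). Tup x y) ` (set_pmf P \<times> set_pmf Q)"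
  by (simp add: tensor_obj_def)

lemma card_tensor: "card (set_pmf (P \<otimes>\<^sub>o Q)) = card (set_pmf P) * card (set_pmf Q)"
  unfolding set_tensor by (subst card_image) (auto simp: inj_on_def card_cartesian_product)

lemma point_entropy_H0: "point_entropy (H0 :: 'a point pmf \<Rightarrow> real)"
proof
  fix P :: "'a point pmf" and f :: "'a point \<Rightarrow> 'a point" assume "P \<in> FinProb"
  then have "finite (set_pmf P)" by (simp add: FinProb_def)
  then show "H0 (map_pmf f P) \<le> H0 P"
    using card_set_pmf_pos[of "map_pmf f P"] card_set_pmf_pos[of P] card_image_le[of "set_pmf P" f]
    by (simp add: H0_def)
next
  fix P :: "'a point pmf" and X Y :: "'a point \<Rightarrow> 'a point" assume "P \<in> FinProb"
  then have fin: "finite (set_pmf P)" by (simp add: FinProb_def)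
  let ?J = "map_pmf (\<lambda>x. Tup (X x) (Y x)) P"
  have "set_pmf ?J \<subseteq> set_pmf (map_pmf X P \<otimes>\<^sub>o map_pmf Y P)" by (auto simp: set_tensor)
  then have "card (set_pmf ?J) \<le> card (set_pmf (map_pmf X P)) * card (set_pmf (map_pmf Y P))"
    unfolding card_tensor[symmetric] using fin by (intro card_mono) (simp_all add: set_tensor)
  then have "real (card (set_pmf ?J)) \<le> real (card (set_pmf (map_pmf X P))) * real (card (set_pmf (map_pmf Y P)))"
    by (simp flip: of_nat_mult)
  moreover have "card (set_pmf ?J) > 0" "card (set_pmf (map_pmf X P)) > 0" "card (set_pmf (map_pmf Y P)) > 0"
    by (rule card_set_pmf_pos, simp add: fin)+
  ultimately show "H0 ?J \<le> H0 (map_pmf X P) + H0 (map_pmf Y P)"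
    unfolding H0_def by (subst ln_mult_pos[symmetric]) (simp_all del: set_map_pmf)
next
  fix P Q :: "'a point pmf" assume "P \<in> FinProb" "Q \<in> FinProb"
  then show "H0 (P \<otimes>\<^sub>o Q) = H0 P + H0 Q"
    using card_set_pmf_pos[of P] card_set_pmf_pos[of Q] by (simp add: H0_def card_tensor ln_mult FinProb_def set_pmf_not_empty)
qed (simp add: H0_def unit_obj_def)

lemma point_entropy_H1: "point_entropy (H1 :: 'a point pmf \<Rightarrow> real)"
  by standard (simp_all add: FinProb_def H1_mono H1_subadditive H1_tensor unit_obj_def,
      simp add: H1_def)

lemma point_entropy_Pair:
  fixes F :: "'a point pmf \<Rightarrow> 'v::ordered_ab_group_add" and G :: "'a point pmf \<Rightarrow> 'w::ordered_ab_group_add"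
  assumes "point_entropy F" "point_entropy G"
  shows "point_entropy (\<lambda>P. (F P, G P))"
proof -
  interpret F: point_entropy F by fact
  interpret G: point_entropy G by fact
  show ?thesis
    by standard (simp_all add: less_eq_prod_def F.mono G.mono F.subadditive G.subadditive
        F.tensor G.tensor F.unit G.unit zero_prod_def)
qed

text \<open>An additive order-reflecting map pulls back inequalities between sums, and equations by
  antisymmetry. It serves the two subtypes of the reals, with \<open>r\<close> the representation
  map.\<close>

lemma point_entropy_reflect:
  assumes "point_entropy G"
    and "\<And>P. P \<in> FinProb \<Longrightarrow> r (F P) = G P"
    and "\<And>x y. r x \<le> r y \<Longrightarrow> x \<le> y" "\<And>x y. r (x + y) = r x + r y" "r 0 = 0"
  shows "point_entropy F"
proof -
  interpret G: point_entropy G by fact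
  have eq: "r x = r y \<Longrightarrow> x = y" for x y
    using assms(3)[of x y] assms(3)[of y x] by simp
  show ?thesis
    by standard (auto intro!: assms(3) eq simp: assms(2,4,5) G.mono G.subadditive G.tensor G.unit)
qed

lemma point_entropy_log_rat_H0: "point_entropy (\<lambda>P. Abs_log_rat (H0 P))"
  by (rule point_entropy_reflect[OF point_entropy_H0, where r = Rep_log_rat])
    (simp_all add: Rep_log_rat_H0 less_eq_log_rat.rep_eq plus_log_rat.rep_eq zero_log_rat.rep_eq)

lemma point_entropy_rat_log_rat_H0: "point_entropy (\<lambda>P. Abs_rat_log_rat (H0 P))"
  by (rule point_entropy_reflect[OF point_entropy_H0, where r = Rep_rat_log_rat])
    (simp_all add: Rep_rat_log_rat_H0 less_eq_rat_log_rat.rep_eq plus_rat_log_rat.rep_eq zero_rat_log_rat.rep_eq)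

section \<open>The two entropies determine the order\<close>

primrec tensor_power :: "nat \<Rightarrow> 'a point pmf \<Rightarrow> 'a point pmf" where
  "tensor_power 0 P = unit_obj"
| "tensor_power (Suc n) P = P \<otimes>\<^sub>o tensor_power n P"

lemma tensor_power_in_FinProb [simp]: "P \<in> FinProb \<Longrightarrow> tensor_power n P \<in> FinProb"
  by (induction n) simp_all

lemma (in point_entropy) tensor_power: "P \<in> FinProb \<Longrightarrow> H (tensor_power n P) = nmult n (H P)"
  by (induction n) (simp_all add: unit tensor nmult_Suc add.commute)

lemma card_tensor_power: "card (set_pmf (tensor_power n P)) = card (set_pmf P) ^ n"
  by (induction n) (simp_all add: card_tensor, simp add: unit_obj_def)

lemma nmult_real: "nmult n (x :: real) = real n * x"
  by (simp add: nmult_def)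

lemma H1_tensor_power: "P \<in> FinProb \<Longrightarrow> H1 (tensor_power n P) = real n * H1 P"
  using point_entropy.tensor_power[OF point_entropy_H1] by (simp add: nmult_real)

lemma info_variance_tensor_power:
  "P \<in> FinProb \<Longrightarrow> info_variance (tensor_power n P) = real n * info_variance P"
proof (induction n)
  case 0
  then show ?case by (simp add: info_variance_def unit_obj_def) (simp add: H1_def)
qed (simp add: info_variance_tensor algebra_simps)

definition uniform_point :: "nat \<Rightarrow> 'a point pmf" where
  "uniform_point n = map_pmf tuple_code (unif n)"

lemma uniform_point:
  assumes "n > 0"
  shows "(uniform_point n :: 'a point pmf) \<in> FinProb"
    and "H0 (uniform_point n :: 'a point pmf) = ln (real n)"
    and "H1 (uniform_point n :: 'a point pmf) = ln (real n)"
proof -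
  have inj: "inj_on (tuple_code :: nat \<Rightarrow> 'a point) A" for A
    using inj_tuple_code inj_on_subset by blast
  show "(uniform_point n :: 'a point pmf) \<in> FinProb"
    using assms by (simp add: FinProb_def uniform_point_def)
  show "H0 (uniform_point n :: 'a point pmf) = ln (real n)"
    using assms by (simp add: H0_def uniform_point_def card_image[OF inj])
  have "H1 (uniform_point n :: 'a point pmf) = - (\<Sum>x<n. 1 / real n * ln (1 / real n))"
    using assms unfolding uniform_point_def
    by (subst H1_map_pmf) (auto simp: pmf_map_inj'[OF inj_tuple_code] lessThan_empty_iff intro!: sum.cong)
  then show "H1 (uniform_point n :: 'a point pmf) = ln (real n)"
    using assms by (simp add: ln_div)
qed

lemma eventually_exp_dominates:
  fixes c d :: real
  assumes "c < d" "0 < d"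
  shows "eventually (\<lambda>N. 2 * real N + 2 * exp (real N * c) \<le> exp (real N * d)) sequentially"
proof -
  have "(\<lambda>N. 2 * (real N * exp (- d) ^ N) + 2 * exp (c - d) ^ N) \<longlonglongrightarrow> 2 * 0 + 2 * 0"
    using assms by (intro tendsto_intros powser_times_n_limit_0 LIMSEQ_realpow_zero) auto
  then have "eventually (\<lambda>N. 2 * (real N * exp (- d) ^ N) + 2 * exp (c - d) ^ N < 1) sequentially"
    by (rule order_tendstoD) simp
  then show ?thesis
  proof (rule eventually_mono)
    fix N assume "2 * (real N * exp (- d) ^ N) + 2 * exp (c - d) ^ N < 1"
    then have "(2 * (real N * exp (- (real N * d))) + 2 * exp (real N * c - real N * d)) * exp (real N * d)
        \<le> 1 * exp (real N * d)"
      by (intro mult_right_mono) (simp_all add: right_diff_distrib flip: exp_of_nat_mult)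
    then show "2 * real N + 2 * exp (real N * c) \<le> exp (real N * d)"
      by (simp add: distrib_right mult.assoc flip: exp_add)
  qed
qed

context
  fixes H :: "'a point pmf \<Rightarrow> 'w::ic_ordered_ab_group_add"
  assumes H: "point_entropy H"
begin

interpretation point_entropy H by (rule H)

lemma nonneg: "P \<in> FinProb \<Longrightarrow> 0 \<le> H P"
  using ent_nonneg[of P] by (simp add: ent_point FinProb_def)

text \<open>At the threshold \<open>\<theta> = exp (- N c)\<close> with \<open>c\<close> strictly between the Shannon entropies, most of the mass of
  the \<open>N\<close>-th power of \<open>P\<close> lies on atoms below \<open>\<theta>\<close>, and most of that of \<open>Q\<close> on atoms above \<open>\<theta>\<close>.\<close>

lemma nmult_tensor_power_le:
  assumes P: "P \<in> FinProb" and Q: "Q \<in> FinProb"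
    and card: "card (set_pmf Q) \<le> card (set_pmf P)"
    and q: "q \<ge> 2" and N: "N > 0" and \<eta>: "\<eta> > 0"
    and gap: "H1 Q + \<eta> \<le> c" "c + \<eta> \<le> H1 P"
    and var: "2 * real q * info_variance P \<le> real N * \<eta>\<^sup>2" "2 * real q * info_variance Q \<le> real N * \<eta>\<^sup>2"
    and large: "2 * real q + 2 * exp (real N * c) \<le> real (card (set_pmf P)) ^ N"
  shows "nmult q (nmult N (H Q)) \<le> nmult q (nmult N (H P) + ent H (unif 2) + ent H (unif 2))
    + nmult N (ent H (unif (card (set_pmf P))) + ent H (unif (card (set_pmf Q))))"
proof -
  let ?X = "tensor_power N P" and ?Y = "tensor_power N Q"
  define \<theta> where "\<theta> = exp (- (real N * c))"
  have fin: "finite (set_pmf ?X)" "finite (set_pmf ?Y)"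
    using P Q tensor_power_in_FinProb unfolding FinProb_def by blast+
  have pos: "card (set_pmf P) > 0" "card (set_pmf Q) > 0"
    using P Q by (simp_all add: card_set_pmf_pos FinProb_def)
  have N\<eta>: "real N * \<eta> > 0" using N \<eta> by simp
  have chebyshev: "measure (tensor_power N R) {x. real N * \<eta> \<le> \<bar>ln (pmf (tensor_power N R) x) + real N * H1 R\<bar>}
      \<le> 1 / (2 * real q)"
    if R: "R \<in> FinProb" and v: "2 * real q * info_variance R \<le> real N * \<eta>\<^sup>2" for R :: "'a point pmf"
  proof -
    have "measure (tensor_power N R) {x. real N * \<eta> \<le> \<bar>ln (pmf (tensor_power N R) x) + real N * H1 R\<bar>}
        \<le> real N * info_variance R / (real N * \<eta>)\<^sup>2"
      using info_chebyshev[OF tensor_power_in_FinProb[OF R] N\<eta>, of N] R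
      by (simp add: H1_tensor_power info_variance_tensor_power)
    also have "\<dots> \<le> 1 / (2 * real q)"
      using v q N \<eta> by (simp add: field_simps power2_eq_square)
    finally show ?thesis .
  qed
  have "measure ?X {x. \<theta> < pmf ?X x} \<le>
      measure ?X {x. real N * \<eta> \<le> \<bar>ln (pmf ?X x) + real N * H1 P\<bar>}"
  proof (intro measure_pmf.finite_measure_mono subsetI)
    fix x assume "x \<in> {x. \<theta> < pmf ?X x}"
    then have "- (real N * c) < ln (pmf ?X x)"
      unfolding \<theta>_def by (simp add: ln_gt_zero less_le_trans order_less_trans[OF exp_gt_zero] flip: exp_less_cancel_iff[of "- (real N * c)"])
    moreover have "real N * (c + \<eta>) \<le> real N * H1 P" using gap by (intro mult_left_mono) auto
    ultimately show "x \<in> {x. real N * \<eta> \<le> \<bar>ln (pmf ?X x) + real N * H1 P\<bar>}"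
      by (simp add: distrib_left)
  qed simp
  also have "\<dots> \<le> 1 / (2 * real q)" using chebyshev[OF P] var by simp
  finally have heavy: "measure ?X {x. \<theta> < pmf ?X x} \<le> 1 / (2 * real q)" .
  have "measure ?Y {y. pmf ?Y y < \<theta>} = measure ?Y ({y. pmf ?Y y < \<theta>} \<inter> set_pmf ?Y)"
    by (rule measure_Int_set_pmf[symmetric])
  also have "\<dots> \<le> measure ?Y {y. real N * \<eta> \<le> \<bar>ln (pmf ?Y y) + real N * H1 Q\<bar>}"
  proof (intro measure_pmf.finite_measure_mono subsetI)
    fix y assume y: "y \<in> {y. pmf ?Y y < \<theta>} \<inter> set_pmf ?Y"
    then have "0 < pmf ?Y y" by (simp add: pmf_positive)
    then have "ln (pmf ?Y y) < - (real N * c)"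
      using y unfolding \<theta>_def by (simp flip: exp_less_cancel_iff[of _ "- (real N * c)"])
    moreover have "real N * (H1 Q + \<eta>) \<le> real N * c" using gap by (intro mult_left_mono) auto
    ultimately show "y \<in> {y. real N * \<eta> \<le> \<bar>ln (pmf ?Y y) + real N * H1 Q\<bar>}"
      by (simp add: distrib_left)
  qed simp
  also have "\<dots> \<le> 1 / (2 * real q)" using chebyshev[OF Q] var by simp
  also have "\<dots> \<le> 1 / real q" using q by (simp add: field_simps)
  finally have light: "measure ?Y {y. pmf ?Y y < \<theta>} \<le> 1 / real q" .
  have large': "2 * real q + 2 / \<theta> \<le> real (card (set_pmf ?X))"
    using large by (simp add: \<theta>_def card_tensor_power exp_minus field_simps)
  obtain X' :: "('a point + 'a point) pmf" where X': "finite (set_pmf X')" "card (set_pmf X') = card (set_pmf ?X)"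
    "\<And>z. pmf X' z \<le> \<theta>"
    "nmult q (ent H X') \<le> nmult q (ent H ?X) + ent H (unif (card (set_pmf ?X)))"
    using exists_spread[OF H fin(1) q _ heavy large'] by (auto simp: \<theta>_def)
  \<comment> \<open>The Hartley entropies enter here: spreading keeps the number of atoms, so the
    powers inherit the comparison of \<open>P\<close> and \<open>Q\<close>.\<close>
  have card': "card (set_pmf ?Y) \<le> card (set_pmf X')"
    using card by (simp add: X'(2) card_tensor_power power_mono)
  have "nmult q (ent H ?Y) \<le> nmult q (ent H X' + ent H (unif 2) + ent H (unif 2)) + ent H (unif (card (set_pmf ?Y)))"
    by (rule ent_le_of_spread[OF H X'(1) fin(2) q X'(3) light card'])
  also have "\<dots> = nmult q (ent H X') + nmult q (ent H (unif 2) + ent H (unif 2)) + ent H (unif (card (set_pmf ?Y)))"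
    by (simp add: nmult_add ac_simps)
  also have "\<dots> \<le> (nmult q (ent H ?X) + ent H (unif (card (set_pmf ?X))))
      + nmult q (ent H (unif 2) + ent H (unif 2)) + ent H (unif (card (set_pmf ?Y)))"
    by (intro add_right_mono X'(4))
  finally show ?thesis
    using P Q pos by (simp add: ent_point tensor_power card_tensor_power ent_unif_power[OF H] nmult_add ac_simps)
qed

lemma le_of_H1_less:
  assumes P: "P \<in> FinProb" and Q: "Q \<in> FinProb" and H0: "H0 Q \<le> H0 P" and H1: "H1 Q < H1 P"
  shows "H Q \<le> H P"
proof -
  have pos: "card (set_pmf P) > 0" "card (set_pmf Q) > 0"
    using P Q by (simp_all add: card_set_pmf_pos FinProb_def)
  have card: "card (set_pmf Q) \<le> card (set_pmf P)"
    using H0 pos by (simp add: H0_def)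
  define c where "c = (H1 P + H1 Q) / 2"
  define \<eta> where "\<eta> = (H1 P - H1 Q) / 2"
  have \<eta>: "\<eta> > 0" "H1 Q + \<eta> \<le> c" "c + \<eta> \<le> H1 P" using H1 by (simp_all add: c_def \<eta>_def field_simps)
  define v where "v = info_variance P + info_variance Q"
  \<comment> \<open>\<open>C\<close> is the number of tensor factors per unit of \<open>q\<close>:
    for \<open>N = C * q\<close> the variance conditions hold, and an error \<open>nmult N L\<close>
    equals \<open>nmult q (nmult C L)\<close>, so \<open>q\<close> factors out. The successor makes
    \<open>C\<close> positive.\<close>
  obtain C0 :: nat where C0: "2 * v / \<eta>\<^sup>2 \<le> real C0" using real_arch_simple by blast
  define C where "C = Suc C0"
  have "2 * v / \<eta>\<^sup>2 \<le> real C" using C0 by (simp add: C_def)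
  then have C: "2 * v \<le> real C * \<eta>\<^sup>2" "C > 0" using \<eta>(1) by (simp_all add: C_def field_simps)
  have H0P: "H1 P \<le> ln (real (card (set_pmf P)))" using H1_le_H0[OF P] by (simp add: H0_def)
  have "eventually (\<lambda>N. 2 * real N + 2 * exp (real N * c) \<le> exp (real N * ln (real (card (set_pmf P))))) sequentially"
    using H0P \<eta> H1 H1_nonneg[of Q] by (intro eventually_exp_dominates) linarith+
  then obtain q0 where q0: "\<And>N. N \<ge> q0 \<Longrightarrow>
      2 * real N + 2 * exp (real N * c) \<le> exp (real N * ln (real (card (set_pmf P))))"
    by (auto simp: eventually_sequentially)
  define y where "y = nmult C (ent H (unif (card (set_pmf P))) + ent H (unif (card (set_pmf Q))))
    + ent H (unif 2) + ent H (unif 2)"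
  have y: "0 \<le> y" unfolding y_def using pos by (intro add_nonneg_nonneg nmult_nonneg ent_nonneg) auto
  have bound: "nmult (C * q) (H Q - H P) \<le> y" if q: "q \<ge> max 2 q0" for q
  proof -
    have qN: "q \<le> C * q" using C(2) by (cases C) auto
    have "nmult q (nmult (C * q) (H Q)) \<le> nmult q (nmult (C * q) (H P) + ent H (unif 2) + ent H (unif 2))
      + nmult (C * q) (ent H (unif (card (set_pmf P))) + ent H (unif (card (set_pmf Q))))"
    proof (rule nmult_tensor_power_le[OF P Q card _ _ \<eta>])
      show "q \<ge> 2" "C * q > 0" using q C(2) by auto
      have "real q * (2 * v) \<le> real q * (real C * \<eta>\<^sup>2)" by (intro mult_left_mono C(1)) simp
      then have *: "2 * real q * v \<le> real (C * q) * \<eta>\<^sup>2" by (simp add: mult_ac)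
      show "2 * real q * info_variance P \<le> real (C * q) * \<eta>\<^sup>2"
        "2 * real q * info_variance Q \<le> real (C * q) * \<eta>\<^sup>2"
        by (intro order_trans[OF _ *] mult_left_mono; simp add: v_def info_variance_nonneg)+
      have "2 * real q + 2 * exp (real (C * q) * c) \<le> 2 * real (C * q) + 2 * exp (real (C * q) * c)"
        using qN by (simp del: of_nat_mult)
      also have "\<dots> \<le> exp (real (C * q) * ln (real (card (set_pmf P))))"
        using q by (intro q0 order_trans[OF _ qN]) simp
      also have "\<dots> = real (card (set_pmf P)) ^ (C * q)"
        using pos(1) by (simp add: exp_of_nat_mult del: of_nat_mult)
      finally show "2 * real q + 2 * exp (real (C * q) * c) \<le> real (card (set_pmf P)) ^ (C * q)" .
    qed
    also have "\<dots> = nmult q (nmult (C * q) (H P) + y)"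
    proof -
      have "nmult (C * q) L = nmult q (nmult C L)" for L :: 'w by (simp only: mult.commute[of C] nmult_mult)
      then show ?thesis by (simp only: y_def nmult_add add.assoc add.commute add.left_commute)
    qed
    finally have le: "nmult q (nmult (C * q) (H Q) - (nmult (C * q) (H P) + y)) \<le> 0"
      by (simp only: nmult_diff[of q] diff_le_0_iff_le)
    \<comment> \<open>Cancelling \<open>q\<close> by \<open>unperforated\<close> asks for a
      nonnegative upper bound of the difference.\<close>
    have "nmult (C * q) (H Q) - (nmult (C * q) (H P) + y) \<le> nmult (C * q) (H Q) - 0"
      using y nonneg[OF P] by (intro diff_mono order.refl add_nonneg_nonneg nmult_nonneg)
    then have "nmult (C * q) (H Q) - (nmult (C * q) (H P) + y) \<le> 0"
      using q nonneg[OF Q] by (intro unperforated[OF le, of "nmult (C * q) (H Q)"]) (simp_all add: nmult_nonneg)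
    then show ?thesis by (simp add: nmult_diff algebra_simps)
  qed
  \<comment> \<open>\<open>bound\<close> holds only for large \<open>q\<close>, so integral
    closedness is applied to multiples of \<open>m\<close>, and \<open>m\<close> is cancelled
    afterwards.\<close>
  define m where "m = C * max 2 q0"
  have "nmult m (H Q - H P) \<le> 0"
  proof (rule nmult_bounded_imp_nonpos)
    fix k :: nat assume "k \<ge> 1"
    then have "max 2 q0 \<le> k * max 2 q0" using mult_le_mono1[of 1 k "max 2 q0"] by linarith
    from bound[OF this] show "nmult k (nmult m (H Q - H P)) \<le> y"
      by (simp only: m_def mult.left_commute flip: nmult_mult)
  qed
  then have "H Q - H P \<le> 0"
    by (rule unperforated[where u = "H Q"])
      (use C(2) nonneg[OF P] nonneg[OF Q] in \<open>simp_all add: m_def\<close>)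
  then show ?thesis by simp
qed

text \<open>A fair bit adjoined to the n-th power of \<open>P\<close> makes the Shannon inequality
  strict, and its entropy stays fixed as n grows, so integral closedness removes it.\<close>

lemma le_of_H0_H1_le:
  assumes P: "P \<in> FinProb" and Q: "Q \<in> FinProb" and H0: "H0 Q \<le> H0 P" and H1: "H1 Q \<le> H1 P"
  shows "H Q \<le> H P"
proof -
  interpret H0: point_entropy "H0 :: 'a point pmf \<Rightarrow> real" by (rule point_entropy_H0)
  let ?U = "uniform_point 2 :: 'a point pmf"
  have U: "?U \<in> FinProb" "H0 ?U = ln 2" "H1 ?U = ln 2" using uniform_point[of 2] by simp_all
  have "H Q - H P \<le> 0"
  proof (rule nmult_bounded_imp_nonpos)
    fix n :: nat
    have "H (tensor_power n Q) \<le> H (tensor_power n P \<otimes>\<^sub>o ?U)"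
    proof (rule le_of_H1_less)
      have le: "real n * H0 Q \<le> real n * H0 P" "real n * H1 Q \<le> real n * H1 P"
        using H0 H1 by (simp_all add: mult_left_mono)
      have ln2: "(0::real) < ln 2" by simp
      have "H0 (tensor_power n P \<otimes>\<^sub>o ?U) = real n * H0 P + ln 2"
        "H1 (tensor_power n P \<otimes>\<^sub>o ?U) = real n * H1 P + ln 2"
        using P U by (simp_all add: H0.tensor H0.tensor_power nmult_real H1_tensor H1_tensor_power)
      then show "H0 (tensor_power n Q) \<le> H0 (tensor_power n P \<otimes>\<^sub>o ?U)"
        "H1 (tensor_power n Q) < H1 (tensor_power n P \<otimes>\<^sub>o ?U)"
        using Q le ln2 by (simp_all only: H0.tensor_power nmult_real H1_tensor_power)
    qed (use P Q U in simp_all)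
    then show "nmult n (H Q - H P) \<le> H ?U"
      using P Q U by (simp add: tensor tensor_power nmult_diff algebra_simps)
  qed
  then show ?thesis by simp
qed

end

section \<open>Universality\<close>

definition binary_point :: "real \<Rightarrow> 'a point pmf" where
  "binary_point p = map_pmf (\<lambda>b. if b then Star else Tup Star Star) (bernoulli_pmf p)"

lemma binary_point:
  assumes "0 < p" "p < 1"
  shows "(binary_point p :: 'a point pmf) \<in> FinProb"
    and "H0 (binary_point p :: 'a point pmf) = ln 2"
    and "H1 (binary_point p :: 'a point pmf) = - (p * ln p + (1 - p) * ln (1 - p))"
proof -
  let ?f = "\<lambda>b. if b then Star else Tup Star Star :: 'a point"
  have inj: "inj ?f" by (auto simp: inj_def)
  show "(binary_point p :: 'a point pmf) \<in> FinProb" by (simp add: FinProb_def binary_point_def)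
  show "H0 (binary_point p :: 'a point pmf) = ln 2"
    using card_image[OF inj] unfolding H0_def binary_point_def set_map_pmf set_pmf_bernoulli[OF assms]
    by (simp only: card_UNIV_bool of_nat_numeral)
  have "H1 (binary_point p :: 'a point pmf) = - (\<Sum>b\<in>UNIV. pmf (bernoulli_pmf p) b * ln (pmf (bernoulli_pmf p) b))"
    using assms unfolding binary_point_def by (subst H1_map_pmf) (simp_all add: pmf_map_inj'[OF inj])
  then show "H1 (binary_point p :: 'a point pmf) = - (p * ln p + (1 - p) * ln (1 - p))"
    using assms by (simp add: UNIV_bool)
qed

text \<open>Nondegenerate binary distributions share the Hartley entropy \<open>ln 2\<close>, while
  their Shannon entropies fill an interval by continuity; tensor powers stretch this interval beyond
  \<open>r\<close>.\<close>

lemma exists_H1_difference: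
  fixes r :: real
  shows "\<exists>P\<in>FinProb. \<exists>Q\<in>FinProb. H0 (P :: 'a point pmf) = H0 (Q :: 'a point pmf) \<and> H1 P - H1 Q = r"
proof -
  interpret H0: point_entropy "H0 :: 'a point pmf \<Rightarrow> real" by (rule point_entropy_H0)
  have nonneg: "\<exists>P\<in>FinProb. \<exists>Q\<in>FinProb. H0 (P :: 'a point pmf) = H0 (Q :: 'a point pmf) \<and> H1 P - H1 Q = r"
    if r: "r \<ge> 0" for r :: real
  proof -
    define h where "h p = - (p * ln p + (1 - p) * ln (1 - p))" for p :: real
    \<comment> \<open>The gap \<open>h (1/4) < h (1/2)\<close> amounts to
      \<open>4 * ln 2 < 3 * ln 3\<close>, that is \<open>16 < 27\<close>.\<close>
    have "ln (16::real) = ln (2 ^ 4)" "ln (27::real) = ln (3 ^ 3)" "ln (4::real) = ln (2 ^ 2)" by simp_all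
    then have "ln (16::real) = 4 * ln 2" "ln (27::real) = 3 * ln 3" "ln (4::real) = 2 * ln 2"
      by (simp_all only: ln_realpow of_nat_numeral)
    moreover have "ln (16::real) < ln 27" by simp
    moreover have "h (1/4) = ln 4 - 3/4 * ln 3" by (simp add: h_def ln_div field_simps)
    moreover have "h (1/2) = ln 2" by (simp add: h_def ln_div)
    ultimately have \<delta>: "h (1/4) < h (1/2)" by simp
    obtain n :: nat where n: "r < real n * (h (1/2) - h (1/4))"
      using reals_Archimedean3[of "h (1/2) - h (1/4)"] \<delta> by auto
    have n0: "n > 0" using n r by (cases n) auto
    have "\<exists>p\<ge>1/4. p \<le> 1/2 \<and> h p = h (1/2) - r / real n"
    proof (rule IVT')
      show "h (1/4) \<le> h (1/2) - r / real n" using n n0 by (simp add: field_simps)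
      show "h (1/2) - r / real n \<le> h (1/2)" using r by simp
      show "continuous_on {1/4..1/2} h" unfolding h_def by (intro continuous_intros) auto
    qed simp
    then obtain p where p: "1/4 \<le> p" "p \<le> 1/2" "h p = h (1/2) - r / real n" by auto
    have H1: "H1 (binary_point s :: 'a point pmf) = h s" if "0 < s" "s < 1" for s
      using binary_point(3)[OF that] by (simp add: h_def)
    let ?P = "binary_point (1/2) :: 'a point pmf" and ?Q = "binary_point p :: 'a point pmf"
    have PQ: "?P \<in> FinProb" "?Q \<in> FinProb" using binary_point(1)[of "1/2"] binary_point(1)[of p] p by simp_all
    have "H0 ?P = ln 2" "H0 ?Q = ln 2" using p by (simp_all add: binary_point(2))
    then have "H0 (tensor_power n ?P) = H0 (tensor_power n ?Q)" using PQ by (simp add: H0.tensor_power)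
    moreover have "H1 (tensor_power n ?P) - H1 (tensor_power n ?Q) = r"
      using PQ p n0 by (simp add: H1_tensor_power H1 right_diff_distrib)
    ultimately show ?thesis
      using PQ by (intro bexI[of _ "tensor_power n ?P"] bexI[of _ "tensor_power n ?Q"]) simp_all
  qed
  show ?thesis
  proof (cases "r \<ge> 0")
    case True
    then show ?thesis by (rule nonneg)
  next
    case False
    then obtain P Q :: "'a point pmf" where PQ: "P \<in> FinProb" "Q \<in> FinProb" "H0 P = H0 Q" "H1 P - H1 Q = - r"
      using nonneg[of "- r"] by auto
    then have "H0 Q = H0 P" "H1 Q - H1 P = r" by simp_all
    then show ?thesis using PQ by blast
  qed
qed

text \<open>Uniform distributions on as many points as numerator and denominator give
  \<open>ln q\<close> in both coordinates; factors from \<open>exists_H1_difference\<close> then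
  correct the Shannon coordinate without touching the other.\<close>

lemma exists_H0_H1_difference:
  fixes q :: rat and r :: real
  assumes "q > 0"
  shows "\<exists>P\<in>FinProb. \<exists>Q\<in>FinProb. H0 (P :: 'a point pmf) - H0 (Q :: 'a point pmf) = ln (of_rat q) \<and> H1 P - H1 Q = r"
proof -
  interpret H0: point_entropy "H0 :: 'a point pmf \<Rightarrow> real" by (rule point_entropy_H0)
  obtain i j where ij: "quotient_of q = (i, j)" by fastforce
  have j: "j > 0" using quotient_of_denom_pos[OF ij] .
  have q: "q = of_int i / of_int j" using quotient_of_div[OF ij] .
  then have i: "i > 0" using assms j by (simp add: zero_less_divide_iff)
  define a b where "a = nat i" and "b = nat j"
  have ab: "a > 0" "b > 0" "(of_rat q :: real) = real a / real b"
    using i j by (simp_all add: a_def b_def q of_rat_divide)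
  let ?A = "uniform_point a :: 'a point pmf" and ?B = "uniform_point b :: 'a point pmf"
  obtain P Q :: "'a point pmf" where PQ: "P \<in> FinProb" "Q \<in> FinProb" "H0 P = H0 Q"
    "H1 P - H1 Q = r - (ln (real a) - ln (real b))"
    using exists_H1_difference by blast
  have A: "?A \<in> FinProb" "H0 ?A = ln (real a)" "H1 ?A = ln (real a)"
    and B: "?B \<in> FinProb" "H0 ?B = ln (real b)" "H1 ?B = ln (real b)"
    using uniform_point ab by blast+
  have "H0 (?A \<otimes>\<^sub>o P) - H0 (?B \<otimes>\<^sub>o Q) = ln (of_rat q)"
    using PQ ab A B by (simp add: H0.tensor ln_div)
  moreover have "H1 (?A \<otimes>\<^sub>o P) - H1 (?B \<otimes>\<^sub>o Q) = r"
    using PQ ab A B by (simp add: H1_tensor)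
  ultimately show ?thesis
    using PQ(1,2) A(1) B(1) by (intro bexI[of _ "?A \<otimes>\<^sub>o P"] bexI[of _ "?B \<otimes>\<^sub>o Q"]) simp_all
qed

text \<open>Since every element is a difference of values, the map is forced. Moving negative terms
  across turns a comparison of differences into one of tensor products, where \<open>dom\<close>
  applies; the resulting \<open>le\<close> yields well-definedness and monotonicity at once.\<close>

lemma exists_unique_ordered_group_hom:
  fixes F :: "'a point pmf \<Rightarrow> 'w::ic_ordered_ab_group_add" and H :: "'a point pmf \<Rightarrow> 'v::ic_ordered_ab_group_add"
  assumes F: "point_entropy F" and H: "point_entropy H"
    and dom: "\<And>P Q. P \<in> FinProb \<Longrightarrow> Q \<in> FinProb \<Longrightarrow> F Q \<le> F P \<Longrightarrow> H Q \<le> H P"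
    and gen: "\<And>v. \<exists>P\<in>FinProb. \<exists>Q\<in>FinProb. v = F P - F Q"
  shows "\<exists>!t. ordered_group_hom t \<and> (\<forall>P\<in>FinProb. H P = t (F P))"
proof -
  interpret F: point_entropy F by (rule F)
  interpret H: point_entropy H by (rule H)
  have "\<exists>p q. \<forall>v. p v \<in> FinProb \<and> q v \<in> FinProb \<and> F (p v) - F (q v) = v"
    using gen by metis
  then obtain p q where pq: "\<And>v. p v \<in> FinProb" "\<And>v. q v \<in> FinProb" "\<And>v. F (p v) - F (q v) = v"
    by blast
  have le: "H P - H Q \<le> H P' - H Q'"
    if in_FinProb: "P \<in> FinProb" "Q \<in> FinProb" "P' \<in> FinProb" "Q' \<in> FinProb" and le: "F P - F Q \<le> F P' - F Q'"
    for P Q P' Q'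
  proof -
    have "F (P \<otimes>\<^sub>o Q') \<le> F (P' \<otimes>\<^sub>o Q)" using in_FinProb le by (simp add: F.tensor algebra_simps)
    then have "H (P \<otimes>\<^sub>o Q') \<le> H (P' \<otimes>\<^sub>o Q)" using in_FinProb by (intro dom) simp_all
    then show ?thesis using in_FinProb by (simp add: H.tensor algebra_simps)
  qed
  define t where "t v = H (p v) - H (q v)" for v
  have t_eq: "t v = H P - H Q" if "P \<in> FinProb" "Q \<in> FinProb" "v = F P - F Q" for v P Q
    unfolding t_def by (intro order.antisym le pq(1,2) that(1,2)) (simp_all add: pq(3) that(3))
  have t_add: "t (v + w) = t v + t w" for v w
  proof -
    have "v + w = F (p v \<otimes>\<^sub>o p w) - F (q v \<otimes>\<^sub>o q w)"
      using arg_cong2[OF pq(3)[of v] pq(3)[of w], of "(+)"] by (simp add: F.tensor pq(1,2) algebra_simps)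
    then have "t (v + w) = H (p v \<otimes>\<^sub>o p w) - H (q v \<otimes>\<^sub>o q w)"
      by (intro t_eq) (simp_all add: pq(1,2))
    then show ?thesis by (simp add: H.tensor pq(1,2) t_def algebra_simps)
  qed
  have "mono t"
    unfolding t_def by (intro monoI le pq(1,2)) (simp add: pq(3))
  then have hom: "ordered_group_hom t" using t_add by (simp add: ordered_group_hom_def Modules.additive_def)
  have factor: "H P = t (F P)" if "P \<in> FinProb" for P
    using t_eq[OF that unit_in_FinProb] by (simp add: F.unit H.unit)
  show ?thesis
  proof (rule ex1I)
    show "ordered_group_hom t \<and> (\<forall>P\<in>FinProb. H P = t (F P))" using hom factor by blast
  next
    fix s assume s: "ordered_group_hom s \<and> (\<forall>P\<in>FinProb. H P = s (F P))"
    then interpret s: Modules.additive s by (simp add: ordered_group_hom_def)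
    show "s = t"
    proof
      fix v
      have "s v = s (F (p v)) - s (F (q v))" by (simp add: pq(3) flip: s.diff)
      then show "s v = t v" using s pq(1,2) by (simp add: t_def)
    qed
  qed
qed

section \<open>Rational scalars and linear maps\<close>

lemma scaleQ_zero [simp]: "a *\<^sub>Q (0 :: 'w::ic_ordered_rat_vector) = 0"
  using scaleQ_add_right[of a "0::'w" 0] by simp

lemma zero_scaleQ [simp]: "0 *\<^sub>Q (x :: 'w::ic_ordered_rat_vector) = 0"
  using scaleQ_add_left[of 0 0 x] by simp

lemma scaleQ_minus_right: "a *\<^sub>Q (- x) = - (a *\<^sub>Q (x :: 'w::ic_ordered_rat_vector))"
  using scaleQ_add_right[of a "- x" x] by (simp add: eq_neg_iff_add_eq_0)

lemma scaleQ_minus_left: "(- a) *\<^sub>Q x = - (a *\<^sub>Q (x :: 'w::ic_ordered_rat_vector))"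
  using scaleQ_add_left[of "- a" a x] by (simp add: eq_neg_iff_add_eq_0)

lemma scaleQ_of_nat: "of_nat n *\<^sub>Q x = nmult n (x :: 'w::ic_ordered_rat_vector)"
  by (induction n) (simp_all add: scaleQ_add_left scaleQ_one nmult_Suc add.commute)

lemma scaleQ_inverse_nmult:
  "n > 0 \<Longrightarrow> inverse (of_nat n) *\<^sub>Q nmult n x = (x :: 'w::ic_ordered_rat_vector)"
  by (simp add: scaleQ_scaleQ scaleQ_one flip: scaleQ_of_nat)

lemma nmult_scaleQ_inverse:
  "n > 0 \<Longrightarrow> nmult n (inverse (of_nat n) *\<^sub>Q x) = (x :: 'w::ic_ordered_rat_vector)"
  by (simp add: scaleQ_scaleQ scaleQ_one flip: scaleQ_of_nat)

lemma nmult_le_cancel: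
  fixes x y :: "'w::ic_ordered_rat_vector"
  assumes "nmult n x \<le> nmult n y" "n > 0"
  shows "x \<le> y"
  using scaleQ_left_mono[OF assms(1), of "inverse (of_nat n)"] assms(2) by (simp add: scaleQ_inverse_nmult)

lemma additive_nmult:
  fixes t :: "'v::ab_group_add \<Rightarrow> 'w::ab_group_add"
  assumes "Modules.additive t"
  shows "t (nmult n x) = nmult n (t x)"
  by (induction n) (simp_all add: nmult_Suc Modules.additive.add[OF assms] Modules.additive.zero[OF assms])

lemma additive_scaleQ:
  fixes t :: "'v::ic_ordered_rat_vector \<Rightarrow> 'w::ic_ordered_rat_vector"
  assumes t: "Modules.additive t"
  shows "t (a *\<^sub>Q x) = a *\<^sub>Q t x"
proof -
  have int: "t (of_int i *\<^sub>Q x) = of_int i *\<^sub>Q t x" for i x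
  proof (cases i)
    case (nonneg n)
    then show ?thesis by (simp add: scaleQ_of_nat additive_nmult[OF t])
  next
    case (neg n)
    have "t (- (of_nat (Suc n) *\<^sub>Q x)) = - (of_nat (Suc n) *\<^sub>Q t x)"
      unfolding Modules.additive.minus[OF t] scaleQ_of_nat additive_nmult[OF t] ..
    then show ?thesis by (simp add: neg scaleQ_minus_left del: of_nat_Suc)
  qed
  obtain i j where ij: "quotient_of a = (i, j)" by fastforce
  have j: "j > 0" and a: "of_int j * a = of_int i"
    using quotient_of_denom_pos[OF ij] quotient_of_div[OF ij] by simp_all
  have "of_int j *\<^sub>Q t (a *\<^sub>Q x) = of_int j *\<^sub>Q (a *\<^sub>Q t x)"
    by (simp add: scaleQ_scaleQ a int flip: int)
  then have "inverse (of_int j) *\<^sub>Q (of_int j *\<^sub>Q t (a *\<^sub>Q x)) = inverse (of_int j) *\<^sub>Q (of_int j *\<^sub>Q (a *\<^sub>Q t x))"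
    by simp
  then show ?thesis using j by (simp add: scaleQ_scaleQ scaleQ_one flip: mult.assoc)
qed

text \<open>Clearing denominators, additivity implies rational linearity, so the construction of the
  map can concentrate on sums and order.\<close>

lemma ordered_linear_map_iff:
  fixes t :: "'v::ic_ordered_rat_vector \<Rightarrow> 'w::ic_ordered_rat_vector"
  shows "ordered_linear_map t \<longleftrightarrow> Modules.additive t \<and> mono t"
proof -
  have "Vector_Spaces.linear scaleQ scaleQ t \<longleftrightarrow> Modules.additive t"
    unfolding Vector_Spaces.linear_iff using vector_space_scaleQ[where 'a = 'v]
      vector_space_scaleQ[where 'a = 'w] additive_scaleQ[of t]
    by (auto simp only: Modules.additive_def)
  then show ?thesis by (simp only: ordered_linear_map_def)
qed

text \<open>Here only a positive multiple of \<open>v\<close> is a difference of values, so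
  \<open>t\<close> divides by \<open>k v\<close>. Elements with different multiples are compared
  through tensor powers that bring them to a common multiple, which \<open>nmult_le_cancel\<close>
  removes.\<close>

lemma exists_unique_ordered_linear_map:
  fixes F :: "'a point pmf \<Rightarrow> 'w::ic_ordered_rat_vector" and H :: "'a point pmf \<Rightarrow> 'v::ic_ordered_rat_vector"
  assumes F: "point_entropy F" and H: "point_entropy H"
    and dom: "\<And>P Q. P \<in> FinProb \<Longrightarrow> Q \<in> FinProb \<Longrightarrow> F Q \<le> F P \<Longrightarrow> H Q \<le> H P"
    and gen: "\<And>v. \<exists>n>0. \<exists>P\<in>FinProb. \<exists>Q\<in>FinProb. nmult n v = F P - F Q"
  shows "\<exists>!t. ordered_linear_map t \<and> (\<forall>P\<in>FinProb. H P = t (F P))"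
proof -
  interpret F: point_entropy F by (rule F)
  interpret H: point_entropy H by (rule H)
  have "\<exists>k p q. \<forall>v. k v > 0 \<and> p v \<in> FinProb \<and> q v \<in> FinProb \<and> nmult (k v) v = F (p v) - F (q v)"
    using gen by metis
  then obtain k p q where pq: "\<And>v. k v > 0" "\<And>v. p v \<in> FinProb" "\<And>v. q v \<in> FinProb"
    "\<And>v. nmult (k v) v = F (p v) - F (q v)"
    by blast
  define t where "t v = inverse (of_nat (k v)) *\<^sub>Q (H (p v) - H (q v))" for v
  have le: "x \<le> y"
    if in_FinProb: "P \<in> FinProb" "Q \<in> FinProb" "P' \<in> FinProb" "Q' \<in> FinProb" and pos: "m > 0" "n > 0"
      and v: "nmult m v = F P - F Q" and w: "nmult n w = F P' - F Q'" and "v \<le> w"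
      and x: "nmult m x = H P - H Q" and y: "nmult n y = H P' - H Q'"
    for P Q P' Q' m n v w x y
  proof -
    have "nmult (n * m) v \<le> nmult (m * n) w" using \<open>v \<le> w\<close> by (simp add: nmult_mono mult.commute)
    then have "nmult n (F P - F Q) \<le> nmult m (F P' - F Q')" by (simp add: nmult_mult v w)
    then have "F (tensor_power n P \<otimes>\<^sub>o tensor_power m Q') \<le> F (tensor_power m P' \<otimes>\<^sub>o tensor_power n Q)"
      using in_FinProb by (simp add: F.tensor F.tensor_power nmult_diff algebra_simps)
    then have "H (tensor_power n P \<otimes>\<^sub>o tensor_power m Q') \<le> H (tensor_power m P' \<otimes>\<^sub>o tensor_power n Q)"
      using in_FinProb by (intro dom) simp_all
    then have "nmult n (H P - H Q) \<le> nmult m (H P' - H Q')"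
      using in_FinProb by (simp add: H.tensor H.tensor_power nmult_diff algebra_simps)
    then have "nmult (n * m) x \<le> nmult (m * n) y" by (simp add: nmult_mult x y)
    then have "nmult (m * n) x \<le> nmult (m * n) y" by (simp only: mult.commute[of n])
    then show "x \<le> y" by (rule nmult_le_cancel) (simp add: pos)
  qed
  have nmult_t: "nmult (k v) (t v) = H (p v) - H (q v)" for v
    unfolding t_def by (rule nmult_scaleQ_inverse[OF pq(1)])
  have t_eq: "t v = x" if "P \<in> FinProb" "Q \<in> FinProb" "n > 0" "nmult n v = F P - F Q" "nmult n x = H P - H Q"
    for n v x P Q
    using le[OF pq(2,3) that(1,2) pq(1) that(3) pq(4) that(4) order.refl nmult_t that(5)]
      le[OF that(1,2) pq(2,3) that(3) pq(1) that(4) pq(4) order.refl that(5) nmult_t]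
    by simp
  have t_add: "t (v + w) = t v + t w" for v w
  proof (rule t_eq)
    \<comment> \<open>The crosswise powers represent the sum at the common multiple
      \<open>k w * k v\<close>.\<close>
    let ?P = "\<lambda>p. tensor_power (k w) (p v) \<otimes>\<^sub>o tensor_power (k v) (p w)"
    show "?P p \<in> FinProb" "?P q \<in> FinProb" "k w * k v > 0" by (simp_all add: pq(1,2,3))
    have "nmult (k w * k v) (v + w) = nmult (k w) (nmult (k v) v) + nmult (k v) (nmult (k w) w)"
      by (simp add: nmult_add mult.commute flip: nmult_mult)
    then show "nmult (k w * k v) (v + w) = F (?P p) - F (?P q)"
      by (simp add: pq F.tensor F.tensor_power nmult_diff algebra_simps)
    have "nmult (k w * k v) (t v + t w) = nmult (k w) (nmult (k v) (t v)) + nmult (k v) (nmult (k w) (t w))"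
      by (simp add: nmult_add mult.commute flip: nmult_mult)
    then show "nmult (k w * k v) (t v + t w) = H (?P p) - H (?P q)"
      by (simp add: nmult_t pq(2,3) H.tensor H.tensor_power nmult_diff algebra_simps)
  qed
  have "mono t"
    by (intro monoI le[OF pq(2,3) pq(2,3) pq(1) pq(1) pq(4) pq(4) _ nmult_t nmult_t])
  then have hom: "ordered_linear_map t" using t_add by (simp add: ordered_linear_map_iff Modules.additive_def)
  have factor: "H P = t (F P)" if "P \<in> FinProb" for P
    using that by (intro t_eq[OF that unit_in_FinProb, of 1, symmetric]) (simp_all add: F.unit H.unit)
  show ?thesis
  proof (rule ex1I)
    show "ordered_linear_map t \<and> (\<forall>P\<in>FinProb. H P = t (F P))" using hom factor by blast
  next
    fix s assume s: "ordered_linear_map s \<and> (\<forall>P\<in>FinProb. H P = s (F P))"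
    then have add: "Modules.additive s" by (simp add: ordered_linear_map_iff)
    show "s = t"
    proof
      fix v
      have "nmult (k v) (s v) = s (F (p v) - F (q v))" by (simp add: additive_nmult[OF add] flip: pq(4))
      also have "\<dots> = H (p v) - H (q v)" using s by (simp add: Modules.additive.diff[OF add] pq(2,3))
      finally have "nmult (k v) (s v) = H (p v) - H (q v)" .
      from t_eq[OF pq(2,3,1,4) this] show "s v = t v" by simp
    qed
  qed
qed

lemma Rep_log_rat_diff: "Rep_log_rat (x - y) = Rep_log_rat x - Rep_log_rat y"
  unfolding minus_log_rat_def plus_log_rat.rep_eq uminus_log_rat.rep_eq by simp

lemma Rep_rat_log_rat_diff: "Rep_rat_log_rat (x - y) = Rep_rat_log_rat x - Rep_rat_log_rat y"
  unfolding minus_rat_log_rat_def uminus_rat_log_rat_def plus_rat_log_rat.rep_eq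
    scaleQ_rat_log_rat.rep_eq by (simp add: of_rat_minus)

lemma Rep_rat_log_rat_nmult: "Rep_rat_log_rat (nmult n x) = real n * Rep_rat_log_rat x"
  by (induction n) (simp_all add: nmult_Suc zero_rat_log_rat.rep_eq plus_rat_log_rat.rep_eq algebra_simps)

lemma fst_nmult: "fst (nmult n x) = nmult n (fst x)"
  by (simp add: nmult_def fst_sum)

lemma snd_nmult: "snd (nmult n x) = nmult n (snd x)"
  by (simp add: nmult_def snd_sum)

lemma ln_of_rat_powi:
  assumes "(b :: rat) > 0"
  shows "ln (of_rat (b powi i) :: real) = of_int i * ln (of_rat b)"
  using assms by (simp add: power_int_def of_rat_power of_rat_inverse ln_realpow ln_inverse
      of_nat_nat power_inverse)

text \<open>Multiplying \<open>a ln b\<close> by the denominator of \<open>a\<close> leaves the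
  logarithm of an integer power of \<open>b\<close>.\<close>

lemma rat_log_rat_multiple:
  "\<exists>n>0. \<exists>q>0. Rep_rat_log_rat (nmult n x) = ln (of_rat q)"
proof -
  obtain a b :: rat where x: "Rep_rat_log_rat x = of_rat a * ln (of_rat b)" and b: "b > 0"
    using Rep_rat_log_rat[of x] by blast
  obtain i j where ij: "quotient_of a = (i, j)" by fastforce
  have j: "j > 0" using quotient_of_denom_pos[OF ij] .
  have a: "(of_rat a :: real) = of_int i / of_int j" using quotient_of_div[OF ij] by (simp add: of_rat_divide)
  have "Rep_rat_log_rat (nmult (nat j) x) = ln (of_rat (b powi i))"
    using j b by (simp add: Rep_rat_log_rat_nmult x a ln_of_rat_powi)
  moreover have "b powi i > 0" using b by (rule zero_less_power_int)
  ultimately show ?thesis using j by (metis zero_less_nat_eq)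
qed

theorem corollary13:
  shows "universal_IcOrdAb_entropy TYPE('v::ic_ordered_ab_group_add)
           (\<lambda>P :: 'a point pmf. (Abs_log_rat (H0 P), H1 P))
       \<and> universal_IcOrdVectQ_entropy TYPE('u::ic_ordered_rat_vector)
           (\<lambda>P :: 'a point pmf. (Abs_rat_log_rat (H0 P), H1 P))"
proof
  let ?F = "\<lambda>P :: 'a point pmf. (Abs_log_rat (H0 P), H1 P)"
  have F: "point_entropy ?F"
    by (rule point_entropy_Pair[OF point_entropy_log_rat_H0 point_entropy_H1])
  have gen: "\<exists>P\<in>FinProb. \<exists>Q\<in>FinProb. v = ?F P - ?F Q" for v :: "log_rat \<times> real"
  proof -
    obtain q :: rat where q: "Rep_log_rat (fst v) = ln (of_rat q)" "q > 0"
      using Rep_log_rat[of "fst v"] by auto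
    obtain P Q :: "'a point pmf" where PQ: "P \<in> FinProb" "Q \<in> FinProb" "H0 P - H0 Q = ln (of_rat q)"
      "H1 P - H1 Q = snd v"
      using exists_H0_H1_difference[OF q(2)] by blast
    then have "v = ?F P - ?F Q"
      by (simp add: prod_eq_iff q(1) Rep_log_rat_diff Rep_log_rat_H0 flip: Rep_log_rat_inject)
    then show ?thesis using PQ(1,2) by blast
  qed
  have dom: "H Q \<le> H P"
    if "point_entropy H" "P \<in> FinProb" "Q \<in> FinProb" "?F Q \<le> ?F P" for H :: "'a point pmf \<Rightarrow> 'v" and P Q
    by (rule le_of_H0_H1_le[OF that(1-3)])
      (use that(2-4) in \<open>simp_all add: less_eq_log_rat.rep_eq Rep_log_rat_H0\<close>)
  show "universal_IcOrdAb_entropy TYPE('v) ?F"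
    unfolding universal_IcOrdAb_entropy_def baseless_entropy_iff
  proof (intro conjI allI impI)
    show "point_entropy ?F" by (rule F)
    fix H' :: "'a point pmf \<Rightarrow> 'v" assume H': "point_entropy H'"
    show "\<exists>!t. ordered_group_hom t \<and> (\<forall>P\<in>FinProb. H' P = t (?F P))"
      by (rule exists_unique_ordered_group_hom[OF F H' dom[OF H'] gen])
  qed
next
  let ?F = "\<lambda>P :: 'a point pmf. (Abs_rat_log_rat (H0 P), H1 P)"
  have F: "point_entropy ?F"
    by (rule point_entropy_Pair[OF point_entropy_rat_log_rat_H0 point_entropy_H1])
  have gen: "\<exists>n>0. \<exists>P\<in>FinProb. \<exists>Q\<in>FinProb. nmult n v = ?F P - ?F Q" for v :: "rat_log_rat \<times> real"
  proof -
    obtain n q where q: "Rep_rat_log_rat (nmult n (fst v)) = ln (of_rat q)" "q > 0" "n > 0"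
      using rat_log_rat_multiple by blast
    obtain P Q :: "'a point pmf" where PQ: "P \<in> FinProb" "Q \<in> FinProb" "H0 P - H0 Q = ln (of_rat q)"
      "H1 P - H1 Q = nmult n (snd v)"
      using exists_H0_H1_difference[OF q(2)] by blast
    then have "nmult n v = ?F P - ?F Q"
      by (simp add: prod_eq_iff fst_nmult snd_nmult q(1) Rep_rat_log_rat_diff Rep_rat_log_rat_H0
          flip: Rep_rat_log_rat_inject)
    then show ?thesis using PQ(1,2) q(3) by blast
  qed
  have dom: "H Q \<le> H P"
    if "point_entropy H" "P \<in> FinProb" "Q \<in> FinProb" "?F Q \<le> ?F P" for H :: "'a point pmf \<Rightarrow> 'u" and P Q
    by (rule le_of_H0_H1_le[OF that(1-3)])
      (use that(2-4) in \<open>simp_all add: less_eq_rat_log_rat.rep_eq Rep_rat_log_rat_H0\<close>)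
  show "universal_IcOrdVectQ_entropy TYPE('u) ?F"
    unfolding universal_IcOrdVectQ_entropy_def baseless_entropy_iff
  proof (intro conjI allI impI)
    show "point_entropy ?F" by (rule F)
    fix H' :: "'a point pmf \<Rightarrow> 'u" assume H': "point_entropy H'"
    show "\<exists>!t. ordered_linear_map t \<and> (\<forall>P\<in>FinProb. H' P = t (?F P))"
      by (rule exists_unique_ordered_linear_map[OF F H' dom[OF H'] gen])
  qed
qed

end
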